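(* Fix a nonnegative integer $n$. Consider the formal power series in $X,Y,Z$ with coefficients in $\mathbb{Q}[x,y,z]$ $$f(X,Y,Z)=(1+X+Y+Z)^{\frac{n+x+y+z}4}(1+X-Y-Z)^{\frac{n+x-y-z}4}(1-X+Y-Z)^{\frac{n-x+y-z}4}(1-X-Y+Z)^{\frac{n-x-y+z}4},$$ where $(1+u)^{\alpha}=\sum_{k\ge0}\binom{\alpha}{k}u^k$ with $\binom{\alpha}{k}=\alpha(\alpha-1)\cdots(\alpha-k+1)/k!$. Then for all nonnegative integers $r_1,r_2,r_3$ with $r_1+r_2+r_3\le n$, the coefficient of $X^{r_1}Y^{r_2}Z^{r_3}$ in $f$ equals $P^{r_1,r_2,r_3}(x,y,z)$.
   Context: The $n$-cube $H^n$ has as vertices the binary words of length $n$, adjacent iff they differ in exactly one position; $d$ is the graph distance. An equitable partition is an ordered partition $C=(C_1,\dots,C_m)$ of the vertex set such that every vertex of $C_i$ has the same number $S_{ij}$ of neighbours in $C_j$; $S=(S_{ij})$ is the quotient matrix. $T^{r_1,r_2,r_3}$ is the row vector of length $m^3$ indexed by $(i,j,k)$ with $T^{r_1,r_2,r_3}_{ijk}$ the number of vertex triples $(v,x,y)$, $v\in C_i,x\in C_j,y\in C_k$, with $d(x,y)=r_2+r_3$, $d(v,y)=r_1+r_3$, $d(v,x)=r_1+r_2$. $S'=S\otimes I\otimes I$, $S''=I\otimes S\otimes I$, $S'''=I\otimes I\otimes S$ act on row vectors by $(US')_{ijk}=\sum_t U_{tjk}S_{ti}$, $(US'')_{ijk}=\sum_t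 U_{itk}S_{tj}$, $(US''')_{ijk}=\sum_t U_{ijt}S_{tk}$ (they pairwise commute). For $r_1+r_2+r_3\le n$, $P^{r_1,r_2,r_3}(x,y,z)$ denotes the unique polynomial of degree at most $r_1+r_2+r_3$ such that $T^{r_1,r_2,r_3}=T^{0,0,0}P^{r_1,r_2,r_3}(S',S'',S''')$ for every equitable partition of $H^n$. *)

theory Defs
  imports
    Complex_Main
    "HOL-Library.Disjoint_Sets"
    "HOL-Library.Product_Plus"
    "HOL-Library.Poly_Mapping"
    "HOL-Computational_Algebra.Formal_Power_Series"
begin

definition cube_verts :: "nat \<Rightarrow> bool list set" where
  "cube_verts n = {v. length v = n}"

definition cube_edges :: "nat \<Rightarrow> (bool list \<times> bool list) set" where
  "cube_edges n = {(u, v). u \<in> cube_verts n \<and> v \<in> cube_verts n \<and>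
                           card {i. i < n \<and> u ! i \<noteq> v ! i} = 1}"

text \<open>Graph distance: the length of a shortest walk (the cube is connected).\<close>

definition cube_dist :: "nat \<Rightarrow> bool list \<Rightarrow> bool list \<Rightarrow> nat" where
  "cube_dist n u v = (LEAST k. (u, v) \<in> cube_edges n ^^ k)"

text \<open>
  An ordered partition is a list of cells; \<open>S\<close> is the quotient matrix, determined by the
  partition for indices below the number of cells because the cells are nonempty.
\<close>

definition equitable_partition ::
    "nat \<Rightarrow> bool list set list \<Rightarrow> (nat \<Rightarrow> nat \<Rightarrow> nat) \<Rightarrow> bool" where
  "equitable_partition n C S \<longleftrightarrow>
     distinct C \<and> partition_on (cube_verts n) (set C) \<and>
     (\<forall>i<length C. \<forall>j<length C. \<forall>v\<in>C ! i.
        card {w \<in> C ! j. (v, w) \<in> cube_edges n} = S i j)"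

text \<open>
  Row vectors of length \<open>m ^ 3\<close> are functions of three indices, only the values at indices
  below \<open>m\<close> being relevant.
\<close>

type_synonym row3 = "nat \<Rightarrow> nat \<Rightarrow> nat \<Rightarrow> rat"

definition triple_vec :: "nat \<Rightarrow> bool list set list \<Rightarrow> nat \<Rightarrow> nat \<Rightarrow> nat \<Rightarrow> row3" where
  "triple_vec n C r1 r2 r3 = (\<lambda>i j k. of_nat (card
     {(v, x, y). v \<in> C ! i \<and> x \<in> C ! j \<and> y \<in> C ! k \<and>
        cube_dist n x y = r2 + r3 \<and> cube_dist n v y = r1 + r3 \<and> cube_dist n v x = r1 + r2}))"

text \<open>Right multiplication of a row vector by $S'$, $S''$ and $S'''$, respectively.\<close>

definition act1 :: "nat \<Rightarrow> (nat \<Rightarrow> nat \<Rightarrow> nat) \<Rightarrow> row3 \<Rightarrow> row3" where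
  "act1 m S U = (\<lambda>i j k. \<Sum>t<m. U t j k * of_nat (S t i))"

definition act2 :: "nat \<Rightarrow> (nat \<Rightarrow> nat \<Rightarrow> nat) \<Rightarrow> row3 \<Rightarrow> row3" where
  "act2 m S U = (\<lambda>i j k. \<Sum>t<m. U i t k * of_nat (S t j))"

definition act3 :: "nat \<Rightarrow> (nat \<Rightarrow> nat \<Rightarrow> nat) \<Rightarrow> row3 \<Rightarrow> row3" where
  "act3 m S U = (\<lambda>i j k. \<Sum>t<m. U i j t * of_nat (S t k))"

text \<open>
  The ring $\mathbf{Q}[x,y,z]$: the key \<open>(a, b, c)\<close> is the monomial $x^a y^b z^c$.
\<close>

type_synonym qpoly3 = "(nat \<times> nat \<times> nat) \<Rightarrow>\<^sub>0 rat"

definition pconst :: "rat \<Rightarrow> qpoly3" where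
  "pconst q = Poly_Mapping.single 0 q"

definition px :: qpoly3 where
  "px = Poly_Mapping.single (1, 0, 0) 1"

definition py :: qpoly3 where
  "py = Poly_Mapping.single (0, 1, 0) 1"

definition pz :: qpoly3 where
  "pz = Poly_Mapping.single (0, 0, 1) 1"

text \<open>The total degree; the zero polynomial is given degree 0.\<close>

definition total_degree :: "qpoly3 \<Rightarrow> nat" where
  "total_degree p = Max (insert 0 ((\<lambda>(a, b, c). a + b + c) ` Poly_Mapping.keys p))"

text \<open>The row vector $U\,p(S',S'',S''')$.\<close>

definition poly_act :: "nat \<Rightarrow> (nat \<Rightarrow> nat \<Rightarrow> nat) \<Rightarrow> qpoly3 \<Rightarrow> row3 \<Rightarrow> row3" where
  "poly_act m S p U = (\<lambda>i j k. \<Sum>(a, b, c)\<in>Poly_Mapping.keys p.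
     Poly_Mapping.lookup p (a, b, c) *
       (act3 m S ^^ c) ((act2 m S ^^ b) ((act1 m S ^^ a) U)) i j k)"

definition is_triple_poly :: "nat \<Rightarrow> nat \<Rightarrow> nat \<Rightarrow> nat \<Rightarrow> qpoly3 \<Rightarrow> bool" where
  "is_triple_poly n r1 r2 r3 p \<longleftrightarrow>
     total_degree p \<le> r1 + r2 + r3 \<and>
     (\<forall>C S. equitable_partition n C S \<longrightarrow>
        (\<forall>i<length C. \<forall>j<length C. \<forall>k<length C.
           triple_vec n C r1 r2 r3 i j k =
           poly_act (length C) S p (triple_vec n C 0 0 0) i j k))"

definition triple_poly :: "nat \<Rightarrow> nat \<Rightarrow> nat \<Rightarrow> nat \<Rightarrow> qpoly3" where
  "triple_poly n r1 r2 r3 = (THE p. is_triple_poly n r1 r2 r3 p)"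

text \<open>
  Power series in $X,Y,Z$ over $\mathbf{Q}[x,y,z]$ are iterated univariate ones, with $X$
  the innermost and $Z$ the outermost indeterminate.
\<close>

type_synonym series3 = "qpoly3 fps fps fps"

definition coeff3 :: "series3 \<Rightarrow> nat \<Rightarrow> nat \<Rightarrow> nat \<Rightarrow> qpoly3" where
  "coeff3 F r1 r2 r3 = fps_nth (fps_nth (fps_nth F r3) r2) r1"

definition sX :: series3 where
  "sX = fps_const (fps_const fps_X)"

definition sY :: series3 where
  "sY = fps_const fps_X"

definition sZ :: series3 where
  "sZ = fps_X"

text \<open>The library's \<open>gbinomial\<close> is not available on this coefficient ring.\<close>

definition pbinom :: "qpoly3 \<Rightarrow> nat \<Rightarrow> qpoly3" where
  "pbinom \<alpha> k = pconst (1 / fact k) * (\<Prod>i<k. \<alpha> - of_nat i)"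

text \<open>
  The series $(1+u)^\alpha = \sum_{k\ge 0} \binom{\alpha}{k} u^k$ for \<open>u\<close> without constant
  term. The infinite sum is taken coefficientwise: for such \<open>u\<close> only finitely many \<open>k\<close>
  contribute to each coefficient, and \<open>Sum_any\<close> adds up the nonzero contributions.
\<close>

definition binom_series :: "series3 \<Rightarrow> qpoly3 \<Rightarrow> series3" where
  "binom_series u \<alpha> =
     Abs_fps (\<lambda>r3. Abs_fps (\<lambda>r2. Abs_fps (\<lambda>r1.
       Sum_any (\<lambda>k. pbinom \<alpha> k * coeff3 (u ^ k) r1 r2 r3))))"

definition gen_series :: "nat \<Rightarrow> series3" where
  "gen_series n =
     binom_series (sX + sY + sZ) (pconst (1 / 4) * (of_nat n + px + py + pz)) *
     binom_series (sX - sY - sZ) (pconst (1 / 4) * (of_nat n + px - py - pz)) *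
     binom_series (- sX + sY - sZ) (pconst (1 / 4) * (of_nat n - px + py - pz)) *
     binom_series (- sX - sY + sZ) (pconst (1 / 4) * (of_nat n - px - py + pz))"

end

theory Submission imports Defs begin

text \<open>
  A triple of vertices has a type $(r_1,r_2,r_3)$, and flipping one position of \<open>v\<close>, \<open>x\<close> or
  \<open>y\<close> changes the type in a way that depends on the type only. Hence $T^{r}S'$ is an explicit
  combination of $(r_1+1)\,T^{r_1+1,r_2,r_3}$ and vectors $T^{s}$ with $|s|\le|r|$, and similarly
  for $S''$ and $S'''$. The same recurrence holds for the coefficients of $f$, because
  $$\bigl(\partial_X - X(X\partial_X+Y\partial_Y+Z\partial_Z) + Z\partial_Y + Y\partial_Z\bigr) f
    = (x - nX) f$$
  and its two analogues hold: every factor of $f$ is an eigenfunction up to a linear form in $X$.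
  Induction on $|r|$ shows that the coefficients of $f$ have the required property. For
  uniqueness, take the partition into singletons: $T^{0,0,0}$ times a monomial $x^ay^bz^c$
  vanishes at triples of type $s$ with $|s|\ge a+b+c$ except for $s=(a,b,c)$, where it does not
  vanish; so a nonzero polynomial of degree at most $n$ acts nontrivially on $T^{0,0,0}$.
\<close>

section \<open>Types of vertex triples\<close>

definition hamming :: "nat \<Rightarrow> bool list \<Rightarrow> bool list \<Rightarrow> nat" where
  "hamming n u v = card {i. i < n \<and> u ! i \<noteq> v ! i}"

lemma hamming_triangle: "hamming n u w \<le> hamming n u v + hamming n v w"
proof -
  have "{i. i < n \<and> u ! i \<noteq> w ! i} \<subseteq>
      {i. i < n \<and> u ! i \<noteq> v ! i} \<union> {i. i < n \<and> v ! i \<noteq> w ! i}" by auto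
  then have "hamming n u w \<le>
      card ({i. i < n \<and> u ! i \<noteq> v ! i} \<union> {i. i < n \<and> v ! i \<noteq> w ! i})"
    unfolding hamming_def by (intro card_mono) auto
  also have "\<dots> \<le> hamming n u v + hamming n v w"
    unfolding hamming_def by (rule card_Un_le)
  finally show ?thesis .
qed

lemma hamming_le_walk:
  assumes "(u, v) \<in> cube_edges n ^^ k"
  shows "hamming n u v \<le> k"
  using assms
proof (induction k arbitrary: v)
  case 0
  then show ?case by (simp add: hamming_def)
next
  case (Suc k)
  then obtain w where "(u, w) \<in> cube_edges n ^^ k" "(w, v) \<in> cube_edges n" by auto
  then have "hamming n u w \<le> k" "hamming n w v = 1"
    using Suc.IH by (auto simp: cube_edges_def hamming_def)
  then show ?case using hamming_triangle[of n u v w] by simp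
qed

text \<open>Correcting one differing position per step gives a walk of exactly this length; with the
  triangle inequality above it is a shortest one.\<close>

lemma walk_hamming:
  assumes "length u = n" "length v = n" "hamming n u v = k"
  shows "(u, v) \<in> cube_edges n ^^ k"
  using assms
proof (induction k arbitrary: u)
  case 0
  then have "{i. i < n \<and> u ! i \<noteq> v ! i} = {}" by (simp add: hamming_def)
  then show ?case using 0 by (auto intro: nth_equalityI)
next
  case (Suc k)
  then have "{i. i < n \<and> u ! i \<noteq> v ! i} \<noteq> {}"
    unfolding hamming_def by (metis card.empty nat.distinct(1))
  then obtain i where i: "i < n" "u ! i \<noteq> v ! i" by auto
  let ?w = "u[i := v ! i]"
  have "{j. j < n \<and> ?w ! j \<noteq> v ! j} = {j. j < n \<and> u ! j \<noteq> v ! j} - {i}"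
    using Suc.prems i by (auto simp: nth_list_update)
  then have "hamming n ?w v = k"
    using Suc.prems i by (simp add: hamming_def)
  then have "(?w, v) \<in> cube_edges n ^^ k"
    using Suc by simp
  moreover have "{j. j < n \<and> u ! j \<noteq> ?w ! j} = {i}"
    using Suc.prems i by (auto simp: nth_list_update)
  then have "(u, ?w) \<in> cube_edges n"
    using Suc.prems by (simp add: cube_edges_def cube_verts_def)
  ultimately show ?case by (meson relpow_Suc_I2)
qed

lemma cube_dist_eq_hamming:
  assumes "length u = n" "length v = n"
  shows "cube_dist n u v = hamming n u v"
  unfolding cube_dist_def
  using walk_hamming[OF assms refl] hamming_le_walk by (rule Least_equality)

text \<open>In each position at most one of three binary words is the odd one out. The paper's
  parameters $r_1, r_2, r_3$ of a triple \<open>(v, x, y)\<close> count the positions where this is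
  \<open>v\<close>, \<open>x\<close>, \<open>y\<close>, respectively.\<close>

definition odd_set :: "nat \<Rightarrow> bool list \<Rightarrow> bool list \<Rightarrow> bool list \<Rightarrow> nat set" where
  "odd_set n v x y = {i. i < n \<and> v ! i \<noteq> x ! i \<and> v ! i \<noteq> y ! i}"

definition odd_card :: "nat \<Rightarrow> bool list \<Rightarrow> bool list \<Rightarrow> bool list \<Rightarrow> nat" where
  "odd_card n v x y = card (odd_set n v x y)"

lemma finite_odd_set [simp]: "finite (odd_set n v x y)"
  by (simp add: odd_set_def)

lemma odd_set_swap: "odd_set n v y x = odd_set n v x y"
  by (auto simp: odd_set_def)

lemma odd_card_swap: "odd_card n v y x = odd_card n v x y"
  by (simp add: odd_card_def odd_set_swap)

text \<open>Over a binary alphabet, if v and x differ at a position, then y agrees with exactly one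
  of them there, so the other is the odd one out.\<close>

lemma hamming_eq_odd_cards: "hamming n v x = odd_card n v x y + odd_card n x v y"
proof -
  have "{i. i < n \<and> v ! i \<noteq> x ! i} = odd_set n v x y \<union> odd_set n x v y"
    by (auto simp: odd_set_def)
  moreover have "odd_set n v x y \<inter> odd_set n x v y = {}"
    by (auto simp: odd_set_def)
  ultimately show ?thesis
    unfolding hamming_def odd_card_def by (simp add: card_Un_disjoint)
qed

text \<open>The three distances are the pairwise sums of the three odd counts, and pairwise sums
  determine the summands. So each entry of T counts triples of one fixed type.\<close>

lemma dists_iff_odd_cards:
  assumes "length v = n" "length x = n" "length y = n"
  shows "cube_dist n x y = r2 + r3 \<and> cube_dist n v y = r1 + r3 \<and> cube_dist n v x = r1 + r2
    \<longleftrightarrow> odd_card n v x y = r1 \<and> odd_card n x v y = r2 \<and> odd_card n y v x = r3"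
proof -
  have "hamming n v x = odd_card n v x y + odd_card n x v y"
    by (rule hamming_eq_odd_cards)
  moreover have "hamming n v y = odd_card n v x y + odd_card n y v x"
    using hamming_eq_odd_cards[of n v y x] by (simp add: odd_card_swap)
  moreover have "hamming n x y = odd_card n x v y + odd_card n y v x"
    using hamming_eq_odd_cards[of n x y v] by (simp add: odd_card_swap)
  ultimately show ?thesis using assms by (auto simp: cube_dist_eq_hamming)
qed

text \<open>The type \<open>row3\<close> is reused here for functions of a triple type: the
  arguments of \<open>g\<close> are odd counts, not cell indices.\<close>

definition type_fun :: "nat \<Rightarrow> row3 \<Rightarrow> bool list \<Rightarrow> bool list \<Rightarrow> bool list \<Rightarrow> rat" where
  "type_fun n g v x y = g (odd_card n v x y) (odd_card n x v y) (odd_card n y v x)"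

text \<open>Flipping a position of \<open>v\<close> interchanges the position types ``all equal'' and
  ``\<open>v\<close> odd'', and the types ``\<open>x\<close> odd'' and ``\<open>y\<close> odd''.\<close>

definition step1 :: "nat \<Rightarrow> row3 \<Rightarrow> row3" where
  "step1 n g = (\<lambda>a b c. of_nat a * g (a - 1) b c + of_nat (n - (a + b + c)) * g (Suc a) b c
     + of_nat b * g a (b - 1) (Suc c) + of_nat c * g a (Suc b) (c - 1))"

text \<open>Exchanging the roles of two words reduces a flip of x or y to a flip of v, so the case
  analysis over positions is carried out once.\<close>

definition step2 :: "nat \<Rightarrow> row3 \<Rightarrow> row3" where
  "step2 n g = (\<lambda>a b c. step1 n (\<lambda>a b c. g b a c) b a c)"

definition step3 :: "nat \<Rightarrow> row3 \<Rightarrow> row3" where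
  "step3 n g = (\<lambda>a b c. step1 n (\<lambda>a b c. g c b a) c b a)"

section \<open>Neighbours as single flips, and their effect on the type\<close>

lemma cube_neighbours:
  assumes "length v = n"
  shows "{w. (v, w) \<in> cube_edges n} = (\<lambda>i. v[i := \<not> v ! i]) ` {..<n}"
proof (intro set_eqI iffI)
  fix w assume "w \<in> {w. (v, w) \<in> cube_edges n}"
  then have w: "length w = n" "card {i. i < n \<and> v ! i \<noteq> w ! i} = 1"
    by (auto simp: cube_edges_def cube_verts_def)
  then obtain i where i: "{i. i < n \<and> v ! i \<noteq> w ! i} = {i}" by (auto simp: card_1_singleton_iff)
  then have "i < n" "\<And>j. j < n \<Longrightarrow> v ! j \<noteq> w ! j \<longleftrightarrow> j = i" by auto
  then have "w = v[i := \<not> v ! i]"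
    using assms w by (intro nth_equalityI) (auto simp: nth_list_update)
  then show "w \<in> (\<lambda>i. v[i := \<not> v ! i]) ` {..<n}" using \<open>i < n\<close> by auto
next
  fix w assume "w \<in> (\<lambda>i. v[i := \<not> v ! i]) ` {..<n}"
  then obtain i where i: "i < n" "w = v[i := \<not> v ! i]" by auto
  then have "{j. j < n \<and> v ! j \<noteq> w ! j} = {i}" using assms by (auto simp: nth_list_update)
  then show "w \<in> {w. (v, w) \<in> cube_edges n}"
    using i assms by (simp add: cube_edges_def cube_verts_def)
qed

lemma inj_on_flip:
  assumes "length v = n"
  shows "inj_on (\<lambda>i. v[i := \<not> v ! i]) {..<n}"
proof (rule inj_onI)
  fix i j assume "i \<in> {..<n}" "j \<in> {..<n}" and eq: "v[i := \<not> v ! i] = v[j := \<not> v ! j]"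
  then have "i < length v" "j < length v" using assms by auto
  then show "i = j" using arg_cong[OF eq, of "\<lambda>w. w ! i"]
    by (cases "i = j") auto
qed

text \<open>The positions split into four classes: v odd (\<open>V\<close>), x odd
  (\<open>X\<close>), y odd (\<open>Y\<close>), all equal (\<open>R\<close>). Flips within one class
  lead to the same new type, so each class contributes its size times a single value of
  \<open>g\<close>.\<close>

lemma sum_neighbours_type_fun:
  assumes len: "length v = n" "length x = n" "length y = n"
  shows "(\<Sum>w | (v, w) \<in> cube_edges n. type_fun n g w x y) = type_fun n (step1 n g) v x y"
proof -
  define V where "V = odd_set n v x y"
  define X where "X = odd_set n x v y"
  define Y where "Y = odd_set n y v x"
  define R where "R = {..<n} - (V \<union> X \<union> Y)"
  define h where "h i = type_fun n g (v[i := \<not> v ! i]) x y" for i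
  note defs = V_def X_def Y_def R_def odd_set_def
  have fin: "finite V" "finite X" "finite Y" "finite R" by (auto simp: defs)
  have disj: "V \<inter> X = {}" "(V \<union> X) \<inter> Y = {}" "(V \<union> X \<union> Y) \<inter> R = {}"
    by (auto simp: defs)
  have un: "{..<n} = V \<union> X \<union> Y \<union> R" by (auto simp: defs)
  have "card {..<n} = card V + card X + card Y + card R"
    unfolding un using fin disj by (simp add: card_Un_disjoint)
  then have cardR: "card R = n - (card V + card X + card Y)" by simp
  have hV: "h i = g (card V - 1) (card X) (card Y)" if "i \<in> V" for i
  proof -
    have "odd_set n (v[i := \<not> v ! i]) x y = V - {i}" "odd_set n x (v[i := \<not> v ! i]) y = X"
      "odd_set n y (v[i := \<not> v ! i]) x = Y"
      using that len by (auto simp: defs nth_list_update split: if_splits)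
    then show ?thesis using that by (simp add: h_def type_fun_def odd_card_def)
  qed
  \<comment> \<open>Here v agrees with y and differs from x; after the flip v agrees with x, so y
    becomes the odd word at this position.\<close>
  have hX: "h i = g (card V) (card X - 1) (Suc (card Y))" if "i \<in> X" for i
  proof -
    have "odd_set n (v[i := \<not> v ! i]) x y = V" "odd_set n x (v[i := \<not> v ! i]) y = X - {i}"
      "odd_set n y (v[i := \<not> v ! i]) x = insert i Y" "i \<notin> Y"
      using that len by (auto simp: defs nth_list_update split: if_splits)
    then show ?thesis using that fin by (simp add: h_def type_fun_def odd_card_def)
  qed
  have hY: "h i = g (card V) (Suc (card X)) (card Y - 1)" if "i \<in> Y" for i
  proof -
    have "odd_set n (v[i := \<not> v ! i]) x y = V" "odd_set n x (v[i := \<not> v ! i]) y = insert i X"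
      "odd_set n y (v[i := \<not> v ! i]) x = Y - {i}" "i \<notin> X"
      using that len by (auto simp: defs nth_list_update split: if_splits)
    then show ?thesis using that fin by (simp add: h_def type_fun_def odd_card_def)
  qed
  have hR: "h i = g (Suc (card V)) (card X) (card Y)" if "i \<in> R" for i
  proof -
    have "odd_set n (v[i := \<not> v ! i]) x y = insert i V" "odd_set n x (v[i := \<not> v ! i]) y = X"
      "odd_set n y (v[i := \<not> v ! i]) x = Y" "i \<notin> V"
      using that len by (auto simp: defs nth_list_update split: if_splits)
    then show ?thesis using that fin by (simp add: h_def type_fun_def odd_card_def)
  qed
  have "(\<Sum>w | (v, w) \<in> cube_edges n. type_fun n g w x y) = sum h {..<n}"
    unfolding cube_neighbours[OF len(1)] h_def
    by (subst sum.reindex[OF inj_on_flip[OF len(1)]]) simp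
  also have "\<dots> = sum h V + sum h X + sum h Y + sum h R"
    unfolding un using fin disj by (simp add: sum.union_disjoint)
  also have "\<dots> = type_fun n (step1 n g) v x y"
    using hV hX hY hR cardR
    by (simp add: type_fun_def step1_def odd_card_def flip: V_def X_def Y_def)
  finally show ?thesis .
qed

section \<open>Sums of type functions over cells, and the action of the quotient matrix on
  them\<close>

definition cell_sum :: "nat \<Rightarrow> bool list set list \<Rightarrow> row3 \<Rightarrow> row3" where
  "cell_sum n C g = (\<lambda>i j k. \<Sum>v\<in>C ! i. \<Sum>x\<in>C ! j. \<Sum>y\<in>C ! k. type_fun n g v x y)"

definition delta3 :: "nat \<Rightarrow> nat \<Rightarrow> nat \<Rightarrow> row3" where
  "delta3 r1 r2 r3 = (\<lambda>a b c. if a = r1 \<and> b = r2 \<and> c = r3 then 1 else 0)"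

lemma finite_cube_verts: "finite (cube_verts n)"
  unfolding cube_verts_def using finite_lists_length_eq[of "UNIV :: bool set" n] by simp

lemma sym_cube_edges: "(u, v) \<in> cube_edges n \<longleftrightarrow> (v, u) \<in> cube_edges n"
proof -
  have "{i. i < n \<and> u ! i \<noteq> v ! i} = {i. i < n \<and> v ! i \<noteq> u ! i}" by auto
  then show ?thesis unfolding cube_edges_def by auto
qed

lemma cell_sum_swap12: "cell_sum n C g i j k = cell_sum n C (\<lambda>a b c. g b a c) j i k"
  unfolding cell_sum_def
  by (subst sum.swap) (simp add: type_fun_def odd_card_swap)

lemma cell_sum_swap13: "cell_sum n C g i j k = cell_sum n C (\<lambda>a b c. g c b a) k j i"
proof -
  have "cell_sum n C g i j k = (\<Sum>x\<in>C ! j. \<Sum>v\<in>C ! i. \<Sum>y\<in>C ! k. type_fun n g v x y)"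
    unfolding cell_sum_def by (rule sum.swap)
  also have "\<dots> = (\<Sum>x\<in>C ! j. \<Sum>y\<in>C ! k. \<Sum>v\<in>C ! i. type_fun n g v x y)"
    by (intro sum.cong refl sum.swap)
  also have "\<dots> = (\<Sum>y\<in>C ! k. \<Sum>x\<in>C ! j. \<Sum>v\<in>C ! i. type_fun n g v x y)"
    by (rule sum.swap)
  finally show ?thesis
    by (simp add: cell_sum_def type_fun_def odd_card_swap)
qed

context
  fixes n C S
  assumes ep: "equitable_partition n C S"
begin

lemma cell_subset: "i < length C \<Longrightarrow> C ! i \<subseteq> cube_verts n"
  using ep by (auto simp: equitable_partition_def partition_on_def)

lemma finite_cell: "i < length C \<Longrightarrow> finite (C ! i)"
  using cell_subset finite_cube_verts finite_subset by blast

lemma length_in_cell: "i < length C \<Longrightarrow> v \<in> C ! i \<Longrightarrow> length v = n"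
  using cell_subset by (auto simp: cube_verts_def)

lemma sum_over_cells: "(\<Sum>t<length C. \<Sum>w\<in>C ! t. h w) = sum h (cube_verts n)"
proof -
  have verts: "cube_verts n = (\<Union>t<length C. C ! t)"
    using ep by (auto simp: equitable_partition_def partition_on_def set_conv_nth)
  have "disjoint (set C)" "distinct C"
    using ep by (auto simp: equitable_partition_def partition_on_def)
  then have "(C ! s) \<inter> (C ! t) = {}" if "s < length C" "t < length C" "s \<noteq> t" for s t
    using that by (metis disjointD nth_eq_iff_index_eq nth_mem)
  then show ?thesis
    unfolding verts using finite_cell by (subst sum.UNION_disjoint) auto
qed

text \<open>Double counting of the edges between two cells.\<close>

lemma sum_quotient_row:
  fixes h :: "bool list \<Rightarrow> rat"
  assumes i: "i < length C"
  shows "(\<Sum>t<length C. (\<Sum>w\<in>C ! t. h w) * of_nat (S t i)) =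
    (\<Sum>v\<in>C ! i. \<Sum>w | (v, w) \<in> cube_edges n. h w)"
proof -
  have "(\<Sum>w\<in>C ! t. h w) * of_nat (S t i) =
      (\<Sum>w\<in>C ! t. \<Sum>v\<in>C ! i. if (v, w) \<in> cube_edges n then h w else 0)"
    if t: "t < length C" for t
  proof -
    have "h w * of_nat (S t i) = (\<Sum>v\<in>C ! i. if (v, w) \<in> cube_edges n then h w else 0)"
      if w: "w \<in> C ! t" for w
    proof -
      have "S t i = card {v \<in> C ! i. (w, v) \<in> cube_edges n}"
        using ep i t w by (auto simp: equitable_partition_def)
      also have "{v \<in> C ! i. (w, v) \<in> cube_edges n} = {v \<in> C ! i. (v, w) \<in> cube_edges n}"
        using sym_cube_edges by blast
      finally show ?thesis using finite_cell[OF i]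
        by (simp add: sum.inter_filter[symmetric])
    qed
    then show ?thesis by (simp add: sum_distrib_right)
  qed
  then have "(\<Sum>t<length C. (\<Sum>w\<in>C ! t. h w) * of_nat (S t i)) =
      (\<Sum>w\<in>cube_verts n. \<Sum>v\<in>C ! i. if (v, w) \<in> cube_edges n then h w else 0)"
    by (simp add: sum_over_cells)
  also have "\<dots> = (\<Sum>v\<in>C ! i. \<Sum>w\<in>cube_verts n. if (v, w) \<in> cube_edges n then h w else 0)"
    by (rule sum.swap)
  also have "\<dots> = (\<Sum>v\<in>C ! i. \<Sum>w | (v, w) \<in> cube_edges n. h w)"
  proof (rule sum.cong[OF refl])
    fix v
    have "{w \<in> cube_verts n. (v, w) \<in> cube_edges n} = {w. (v, w) \<in> cube_edges n}"
      by (auto simp: cube_edges_def)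
    then show "(\<Sum>w\<in>cube_verts n. if (v, w) \<in> cube_edges n then h w else 0) =
        (\<Sum>w | (v, w) \<in> cube_edges n. h w)"
      using finite_cube_verts by (simp add: sum.inter_filter[symmetric])
  qed
  finally show ?thesis .
qed

text \<open>Double counting replaces the quotient matrix by a sum over the neighbours of v, and that
  sum is again a function of the type. The action is thereby computed on type functions,
  independently of the partition.\<close>

lemma act1_cell_sum:
  assumes "i < length C" "j < length C" "k < length C"
  shows "act1 (length C) S (cell_sum n C g) i j k = cell_sum n C (step1 n g) i j k"
proof -
  have "act1 (length C) S (cell_sum n C g) i j k =
      (\<Sum>v\<in>C ! i. \<Sum>w | (v, w) \<in> cube_edges n. \<Sum>x\<in>C ! j. \<Sum>y\<in>C ! k. type_fun n g w x y)"
    unfolding act1_def cell_sum_def by (rule sum_quotient_row[OF assms(1)])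
  also have "\<dots> = (\<Sum>v\<in>C ! i. \<Sum>x\<in>C ! j. \<Sum>w | (v, w) \<in> cube_edges n. \<Sum>y\<in>C ! k. type_fun n g w x y)"
    by (intro sum.cong refl sum.swap)
  also have "\<dots> = (\<Sum>v\<in>C ! i. \<Sum>x\<in>C ! j. \<Sum>y\<in>C ! k. \<Sum>w | (v, w) \<in> cube_edges n. type_fun n g w x y)"
    by (intro sum.cong refl sum.swap)
  also have "\<dots> = cell_sum n C (step1 n g) i j k"
    unfolding cell_sum_def
    by (intro sum.cong refl sum_neighbours_type_fun) (use assms length_in_cell in auto)
  finally show ?thesis .
qed

lemma act2_cell_sum:
  assumes "i < length C" "j < length C" "k < length C"
  shows "act2 (length C) S (cell_sum n C g) i j k = cell_sum n C (step2 n g) i j k"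
proof -
  have "act2 (length C) S (cell_sum n C g) i j k =
      act1 (length C) S (cell_sum n C (\<lambda>a b c. g b a c)) j i k"
    unfolding act1_def act2_def by (subst cell_sum_swap12) simp
  also have "\<dots> = cell_sum n C (step2 n g) i j k"
    by (subst cell_sum_swap12) (simp add: act1_cell_sum assms step2_def)
  finally show ?thesis .
qed

lemma act3_cell_sum:
  assumes "i < length C" "j < length C" "k < length C"
  shows "act3 (length C) S (cell_sum n C g) i j k = cell_sum n C (step3 n g) i j k"
proof -
  have "act3 (length C) S (cell_sum n C g) i j k =
      act1 (length C) S (cell_sum n C (\<lambda>a b c. g c b a)) k j i"
    unfolding act1_def act3_def by (subst cell_sum_swap13) simp
  also have "\<dots> = cell_sum n C (step3 n g) i j k"
    by (subst cell_sum_swap13) (simp add: act1_cell_sum assms step3_def)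
  finally show ?thesis .
qed

lemma triple_vec_eq_cell_sum:
  assumes "i < length C" "j < length C" "k < length C"
  shows "triple_vec n C r1 r2 r3 i j k = cell_sum n C (delta3 r1 r2 r3) i j k"
proof -
  let ?A = "C ! i \<times> C ! j \<times> C ! k"
  let ?P = "\<lambda>(v, x, y). odd_card n v x y = r1 \<and> odd_card n x v y = r2 \<and> odd_card n y v x = r3"
  have fin: "finite ?A" using assms finite_cell by blast
  have "{(v, x, y). v \<in> C ! i \<and> x \<in> C ! j \<and> y \<in> C ! k \<and>
        cube_dist n x y = r2 + r3 \<and> cube_dist n v y = r1 + r3 \<and> cube_dist n v x = r1 + r2} =
      {t \<in> ?A. ?P t}"
  proof -
    have "cube_dist n x y = r2 + r3 \<and> cube_dist n v y = r1 + r3 \<and> cube_dist n v x = r1 + r2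
        \<longleftrightarrow> ?P (v, x, y)"
      if "v \<in> C ! i" "x \<in> C ! j" "y \<in> C ! k" for v x y
      using that assms length_in_cell by (simp add: dists_iff_odd_cards)
    then show ?thesis by blast
  qed
  then have "triple_vec n C r1 r2 r3 i j k = of_nat (card {t \<in> ?A. ?P t})"
    by (simp add: triple_vec_def)
  also have "\<dots> = (\<Sum>t\<in>?A. if ?P t then 1 else 0)"
    using fin by (simp add: sum.inter_filter[symmetric])
  also have "\<dots> = cell_sum n C (delta3 r1 r2 r3) i j k"
    unfolding cell_sum_def sum.cartesian_product
    by (intro sum.cong) (simp_all add: type_fun_def delta3_def split_beta)
  finally show ?thesis .
qed

end

text \<open>At each position at most one word is odd. Identities between type functions may
  therefore be checked for a + b + c \<le> n only, where the natural subtraction in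
  \<open>step1\<close> does not truncate.\<close>

lemma odd_cards_le:
  "odd_card n v x y + odd_card n x v y + odd_card n y v x \<le> n"
proof -
  have "odd_set n v x y \<inter> odd_set n x v y = {}"
    "(odd_set n v x y \<union> odd_set n x v y) \<inter> odd_set n y v x = {}"
    by (auto simp: odd_set_def)
  then have "odd_card n v x y + odd_card n x v y + odd_card n y v x =
      card (odd_set n v x y \<union> odd_set n x v y \<union> odd_set n y v x)"
    by (simp add: odd_card_def card_Un_disjoint)
  also have "\<dots> \<le> card {..<n}" by (intro card_mono) (auto simp: odd_set_def)
  finally show ?thesis by simp
qed

section \<open>Differential equations for the generating series\<close>

definition derivation :: "('a::comm_ring_1 \<Rightarrow> 'a) \<Rightarrow> bool" where
  "derivation D \<longleftrightarrow> (\<forall>f g. D (f + g) = D f + D g) \<and> (\<forall>f g. D (f * g) = f * D g + D f * g)"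

lemma derivationD:
  assumes "derivation D"
  shows derivation_add: "D (f + g) = D f + D g"
    and derivation_mult: "D (f * g) = f * D g + D f * g"
  using assms by (auto simp: derivation_def)

lemma derivation_0: "derivation D \<Longrightarrow> D 0 = 0"
  using derivation_add[of D 0 0] by simp

lemma derivation_sum: "derivation D \<Longrightarrow> D (sum f A) = (\<Sum>a\<in>A. D (f a))"
  by (induction A rule: infinite_finite_induct) (simp_all add: derivation_0 derivation_add)

lemma derivation_1: "derivation D \<Longrightarrow> D 1 = 0"
  using derivation_mult[of D 1 1] by simp

lemma derivation_power:
  assumes "derivation D"
  shows "D (u ^ Suc k) = of_nat (Suc k) * D u * u ^ k"
  by (induction k) (simp_all add: derivation_mult[OF assms] derivation_1[OF assms] algebra_simps)

lemma derivation_fps_deriv: "derivation (fps_deriv :: 'a::comm_ring_1 fps \<Rightarrow> 'a fps)"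
  by (simp add: derivation_def)

definition fps_lift :: "('a::comm_ring_1 \<Rightarrow> 'a) \<Rightarrow> 'a fps \<Rightarrow> 'a fps" where
  "fps_lift D F = Abs_fps (\<lambda>n. D (fps_nth F n))"

lemma fps_lift_nth [simp]: "fps_nth (fps_lift D F) n = D (fps_nth F n)"
  by (simp add: fps_lift_def)

text \<open>Applied to a coefficient of a product, D meets a finite Cauchy sum and obeys the Leibniz
  rule in each summand. Lifting carries the derivative in an inner variable to the outer series
  ring.\<close>

lemma derivation_fps_lift:
  assumes "derivation D"
  shows "derivation (fps_lift D)"
  unfolding derivation_def
  by (auto intro!: fps_ext simp: derivation_sum[OF assms] derivation_add[OF assms] derivation_mult[OF assms] fps_mult_nth sum.distrib)

text \<open>X is the innermost variable, hence two lifts; Y needs one and Z none.\<close>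

definition DX :: "series3 \<Rightarrow> series3" where "DX = fps_lift (fps_lift fps_deriv)"
definition DY :: "series3 \<Rightarrow> series3" where "DY = fps_lift fps_deriv"
definition DZ :: "series3 \<Rightarrow> series3" where "DZ = fps_deriv"

lemma derivation_DX: "derivation DX" and derivation_DY: "derivation DY"
  and derivation_DZ: "derivation DZ"
  by (simp_all add: DX_def DY_def DZ_def derivation_fps_lift derivation_fps_deriv)

definition sconst :: "qpoly3 \<Rightarrow> series3" where
  "sconst p = fps_const (fps_const (fps_const p))"

lemma series3_eqI: "(\<And>r1 r2 r3. coeff3 F r1 r2 r3 = coeff3 G r1 r2 r3) \<Longrightarrow> F = G"
  by (auto intro!: fps_ext simp: coeff3_def)

lemma coeff3_simps [simp]:
  "coeff3 0 r1 r2 r3 = 0"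
  "coeff3 (F + G) r1 r2 r3 = coeff3 F r1 r2 r3 + coeff3 G r1 r2 r3"
  "coeff3 (F - G) r1 r2 r3 = coeff3 F r1 r2 r3 - coeff3 G r1 r2 r3"
  "coeff3 (- F) r1 r2 r3 = - coeff3 F r1 r2 r3"
  "coeff3 (of_nat m * F) r1 r2 r3 = of_nat m * coeff3 F r1 r2 r3"
  "coeff3 (of_int l * F) r1 r2 r3 = of_int l * coeff3 F r1 r2 r3"
  "coeff3 (sconst p * F) r1 r2 r3 = p * coeff3 F r1 r2 r3"
  "coeff3 (sX * F) r1 r2 r3 = (if r1 = 0 then 0 else coeff3 F (r1 - 1) r2 r3)"
  "coeff3 (sY * F) r1 r2 r3 = (if r2 = 0 then 0 else coeff3 F r1 (r2 - 1) r3)"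
  "coeff3 (sZ * F) r1 r2 r3 = (if r3 = 0 then 0 else coeff3 F r1 r2 (r3 - 1))"
  "coeff3 (DX F) r1 r2 r3 = of_nat (Suc r1) * coeff3 F (Suc r1) r2 r3"
  "coeff3 (DY F) r1 r2 r3 = of_nat (Suc r2) * coeff3 F r1 (Suc r2) r3"
  "coeff3 (DZ F) r1 r2 r3 = of_nat (Suc r3) * coeff3 F r1 r2 (Suc r3)"
  by (simp_all add: coeff3_def sconst_def sX_def sY_def sZ_def DX_def DY_def DZ_def
      del: of_nat_Suc)

lemma coeff3_one: "coeff3 1 r1 r2 r3 = (if r1 = 0 \<and> r2 = 0 \<and> r3 = 0 then 1 else 0)"
  by (simp add: coeff3_def)

lemma sconst_simps:
  "sconst (p + q) = sconst p + sconst q"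
  "sconst (p - q) = sconst p - sconst q"
  "sconst (p * q) = sconst p * sconst q"
  "sconst (of_nat m) = of_nat m"
  by (simp_all add: sconst_def fps_of_nat)

section \<open>Binomial series of linear forms\<close>

definition lin_form :: "int \<Rightarrow> int \<Rightarrow> int \<Rightarrow> series3" where
  "lin_form a b c = of_int a * sX + of_int b * sY + of_int c * sZ"

lemma deriv_lin_form:
  "DX (lin_form a b c) = of_int a" "DY (lin_form a b c) = of_int b"
  "DZ (lin_form a b c) = of_int c"
  by (simp_all add: lin_form_def DX_def DY_def DZ_def sX_def sY_def sZ_def fps_eq_iff)

text \<open>The k-th power of a linear form is homogeneous of degree k. Each coefficient of the
  binomial series of a linear form thus receives a contribution from one power only.\<close>

lemma coeff3_lin_form_power_eq_0:
  "r1 + r2 + r3 \<noteq> k \<Longrightarrow> coeff3 (lin_form a b c ^ k) r1 r2 r3 = 0"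
proof (induction k arbitrary: r1 r2 r3)
  case 0
  then show ?case by (simp add: coeff3_one)
next
  case (Suc k)
  then show ?case
    by (simp add: lin_form_def distrib_right mult.assoc)
qed

lemma coeff3_binom_series:
  "coeff3 (binom_series (lin_form a b c) \<alpha>) r1 r2 r3 =
    pbinom \<alpha> (r1 + r2 + r3) * coeff3 (lin_form a b c ^ (r1 + r2 + r3)) r1 r2 r3"
proof -
  let ?f = "\<lambda>k. pbinom \<alpha> k * coeff3 (lin_form a b c ^ k) r1 r2 r3"
  have "coeff3 (binom_series (lin_form a b c) \<alpha>) r1 r2 r3 = Sum_any ?f"
    by (simp add: binom_series_def coeff3_def)
  also have "\<dots> = sum ?f {r1 + r2 + r3}"
    by (rule Sum_any.expand_superset) (auto intro: ccontr simp: coeff3_lin_form_power_eq_0)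
  finally show ?thesis by simp
qed

lemma pconst_mult: "pconst (p * q) = pconst p * pconst q"
  by (simp add: pconst_def mult_single)

lemma pconst_of_nat: "pconst (of_nat m) = of_nat m"
  by (simp add: pconst_def)

text \<open>The coefficient form of the differential equation (1 + u) B' = \<alpha> B for B = (1 +
  u)^\<alpha>.\<close>

lemma pbinom_Suc: "of_nat (Suc k) * pbinom \<alpha> (Suc k) = (\<alpha> - of_nat k) * pbinom \<alpha> k"
proof -
  have "of_nat (Suc k) * pconst (1 / fact (Suc k)) = pconst (1 / fact k)"
    unfolding pconst_of_nat[symmetric] pconst_mult[symmetric]
    by (simp del: of_nat_Suc)
  then have "of_nat (Suc k) * pbinom \<alpha> (Suc k) =
      pconst (1 / fact k) * ((\<Prod>i<k. \<alpha> - of_nat i) * (\<alpha> - of_nat k))"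
    unfolding pbinom_def prod.lessThan_Suc mult.assoc[symmetric] by simp
  then show ?thesis
    by (simp only: pbinom_def mult_ac)
qed

definition euler_op :: "series3 \<Rightarrow> series3" where
  "euler_op F = sX * DX F + sY * DY F + sZ * DZ F"

lemma coeff3_euler_op: "coeff3 (euler_op F) r1 r2 r3 = of_nat (r1 + r2 + r3) * coeff3 F r1 r2 r3"
  by (auto simp: euler_op_def algebra_simps gr0_conv_Suc)

text \<open>The derivation lowers the degree by one, so only the power of exponent r1 + r2 + r3 + 1
  matters; its derivative brings down that exponent, and \<open>pbinom_Suc\<close> absorbs it. An
  abstract D, reading the coefficient at s1, s2, s3 with factor s, lets the three partial
  derivatives share the proof.\<close>

lemma deriv_binom_series_aux:
  assumes D: "derivation D" "D (lin_form a b c) = of_int l"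
    and coeff: "\<And>F. coeff3 (D F) r1 r2 r3 = of_nat s * coeff3 F s1 s2 s3"
    and s: "s1 + s2 + s3 = Suc (r1 + r2 + r3)"
  shows "coeff3 (D (binom_series (lin_form a b c) \<alpha>)) r1 r2 r3 =
    of_int l * ((\<alpha> - of_nat (r1 + r2 + r3)) * coeff3 (binom_series (lin_form a b c) \<alpha>) r1 r2 r3)"
proof -
  let ?u = "lin_form a b c" and ?k = "r1 + r2 + r3"
  have "coeff3 (D (binom_series ?u \<alpha>)) r1 r2 r3 =
      pbinom \<alpha> (Suc ?k) * coeff3 (D (?u ^ Suc ?k)) r1 r2 r3"
    by (simp add: coeff coeff3_binom_series s mult_ac)
  also have "D (?u ^ Suc ?k) = of_nat (Suc ?k) * (of_int l * ?u ^ ?k)"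
    by (simp only: derivation_power[OF D(1)] D(2) mult.assoc)
  also have "coeff3 (of_nat (Suc ?k) * (of_int l * ?u ^ ?k)) r1 r2 r3 =
      of_nat (Suc ?k) * (of_int l * coeff3 (?u ^ ?k) r1 r2 r3)"
    by (simp only: coeff3_simps)
  also have "pbinom \<alpha> (Suc ?k) * (of_nat (Suc ?k) * (of_int l * coeff3 (?u ^ ?k) r1 r2 r3)) =
      of_int l * ((of_nat (Suc ?k) * pbinom \<alpha> (Suc ?k)) * coeff3 (?u ^ ?k) r1 r2 r3)"
    by (simp only: mult_ac)
  also have "\<dots> = of_int l * ((\<alpha> - of_nat ?k) * coeff3 (binom_series ?u \<alpha>) r1 r2 r3)"
    unfolding pbinom_Suc coeff3_binom_series by (simp only: mult_ac)
  finally show ?thesis .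
qed

text \<open>With B = (1 + u)^\<alpha>, the series \<open>E\<close> is \<alpha> (1 + u)^(\<alpha> -
  1), written without division: the Euler operator sends B to u \<open>E\<close>, and subtracting
  this from \<alpha> B = (1 + u) \<open>E\<close> leaves \<open>E\<close>. The first three equations
  are the chain rule.\<close>

lemma deriv_binom_series:
  fixes \<alpha> :: qpoly3 and a b c :: int
  defines "B \<equiv> binom_series (lin_form a b c) \<alpha>"
  defines "E \<equiv> sconst \<alpha> * B - euler_op B"
  shows "DX B = of_int a * E" "DY B = of_int b * E" "DZ B = of_int c * E"
    "E + lin_form a b c * E = sconst \<alpha> * B"
proof -
  have E: "coeff3 E r1 r2 r3 = (\<alpha> - of_nat (r1 + r2 + r3)) * coeff3 B r1 r2 r3" for r1 r2 r3
    by (simp add: E_def coeff3_euler_op left_diff_distrib)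
  show X: "DX B = of_int a * E"
    by (rule series3_eqI, simp only: coeff3_simps(6) E, unfold B_def,
        rule deriv_binom_series_aux[OF derivation_DX deriv_lin_form(1) coeff3_simps(11)]) simp
  show Y: "DY B = of_int b * E"
    by (rule series3_eqI, simp only: coeff3_simps(6) E, unfold B_def,
        rule deriv_binom_series_aux[OF derivation_DY deriv_lin_form(2) coeff3_simps(12)]) simp
  show Z: "DZ B = of_int c * E"
    by (rule series3_eqI, simp only: coeff3_simps(6) E, unfold B_def,
        rule deriv_binom_series_aux[OF derivation_DZ deriv_lin_form(3) coeff3_simps(13)]) simp
  have "euler_op B = lin_form a b c * E"
    by (simp add: euler_op_def X Y Z lin_form_def algebra_simps)
  then show "E + lin_form a b c * E = sconst \<alpha> * B"
    by (simp add: E_def)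
qed

text \<open>The first-order part of the differential operator that represents the action of
  \<open>S'\<close> on generating functions (and, with the variables permuted, of \<open>S''\<close> and \<open>S'''\<close>).\<close>

definition flip_op where
  "flip_op X Y Z D1 D2 D3 F = D1 F - X * (X * D1 F + Y * D2 F + Z * D3 F) + Z * D2 F + Y * D3 F"

text \<open>A combination of derivations is a derivation, so eigenvalues add when eigenfunctions are
  multiplied.\<close>

lemma flip_op_mult:
  assumes "derivation D1" "derivation D2" "derivation D3"
    and "flip_op X Y Z D1 D2 D3 F = p * F" "flip_op X Y Z D1 D2 D3 G = q * G"
  shows "flip_op X Y Z D1 D2 D3 (F * G) = (p + q) * (F * G)"
proof -
  have "flip_op X Y Z D1 D2 D3 (F * G) =
      F * flip_op X Y Z D1 D2 D3 G + flip_op X Y Z D1 D2 D3 F * G"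
    unfolding flip_op_def derivation_mult[OF assms(1)] derivation_mult[OF assms(2)]
      derivation_mult[OF assms(3)] by (simp add: algebra_simps)
  then show ?thesis using assms by (simp add: algebra_simps)
qed

text \<open>Write u = aX + bY + cZ. The sign relations give au = X + cY + bZ, hence a + cY + bZ - Xu
  = (a - X)(1 + u). The left side times E is the operator applied to B, and (1 + u)E = \<alpha>
  B.\<close>

lemma flip_op_eigen:
  fixes X Y Z E B \<alpha> :: "'a::comm_ring_1"
  assumes D: "D1 B = of_int a * E" "D2 B = of_int b * E" "D3 B = of_int c * E"
    and E: "E + (of_int a * X + of_int b * Y + of_int c * Z) * E = \<alpha> * B"
    and abc: "a * a = 1" "b = a * c" "c = a * b"
  shows "flip_op X Y Z D1 D2 D3 B = \<alpha> * (of_int a - X) * B"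
proof -
  let ?a = "of_int a :: 'a" and ?b = "of_int b :: 'a" and ?c = "of_int c :: 'a"
  have abc': "?a * ?a = 1" "?b = ?a * ?c" "?c = ?a * ?b"
    using abc by (metis of_int_mult of_int_1)+
  have "\<alpha> * (?a - X) * B = (?a - X) * (E + (?a * X + ?b * Y + ?c * Z) * E)"
    unfolding E by (simp add: mult_ac)
  also have "\<dots> = ?a * E - X * E * (?a * X + ?b * Y + ?c * Z)
      + (?a * ?a * X - X) * E + (?a * ?b) * Y * E + (?a * ?c) * Z * E"
    by (simp add: algebra_simps)
  also have "\<dots> = ?a * E - X * E * (?a * X + ?b * Y + ?c * Z) + ?c * Y * E + ?b * Z * E"
    by (simp only: abc'(1) flip: abc'(2,3)) simp
  also have "\<dots> = flip_op X Y Z D1 D2 D3 B"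
    by (simp add: flip_op_def D algebra_simps)
  finally show ?thesis by simp
qed

lemma sconst_quarter: "sconst (pconst (1 / 4)) * 4 = 1"
proof -
  have "pconst (1 / 4) * of_nat 4 = 1"
    unfolding pconst_of_nat[symmetric] pconst_mult[symmetric] by (simp add: pconst_def)
  then have "sconst (pconst (1 / 4)) * sconst (of_nat 4) = sconst 1"
    by (metis sconst_simps(3))
  then show ?thesis by (simp only: sconst_simps) (simp add: sconst_def)
qed

lemma gen_series_eq:
  "gen_series n =
     binom_series (lin_form 1 1 1) (pconst (1 / 4) * (of_nat n + px + py + pz)) *
     binom_series (lin_form 1 (-1) (-1)) (pconst (1 / 4) * (of_nat n + px - py - pz)) *
     binom_series (lin_form (-1) 1 (-1)) (pconst (1 / 4) * (of_nat n - px + py - pz)) *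
     binom_series (lin_form (-1) (-1) 1) (pconst (1 / 4) * (of_nat n - px - py + pz))"
  by (simp add: gen_series_def lin_form_def)

lemma flip_op_binom_series:
  fixes a b c :: int and \<alpha> :: qpoly3
  defines "B \<equiv> binom_series (lin_form a b c) \<alpha>"
  assumes "a * a = 1" "b * b = 1" "c = a * b"
  shows "flip_op sX sY sZ DX DY DZ B = sconst \<alpha> * (of_int a - sX) * B"
    "flip_op sY sX sZ DY DX DZ B = sconst \<alpha> * (of_int b - sY) * B"
    "flip_op sZ sY sX DZ DY DX B = sconst \<alpha> * (of_int c - sZ) * B"
proof -
  note D = deriv_binom_series[where a = a and b = b and c = c and \<alpha> = \<alpha>, folded B_def]
  \<comment> \<open>The relations are symmetric in the three signs: each squares to 1 and is the
    product of the other two.\<close>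
  have abc: "b = a * c" "a = b * c" "c * c = 1" "a = c * b" "b = c * a" "c = b * a"
    using assms(2-4) by (auto simp: zmult_eq_1_iff)
  show "flip_op sX sY sZ DX DY DZ B = sconst \<alpha> * (of_int a - sX) * B"
    by (rule flip_op_eigen[where B = B and ?D1.0 = DX and ?D2.0 = DY and ?D3.0 = DZ,
          OF D(1-3) _ assms(2) abc(1) assms(4)])
      (use D(4) in \<open>simp add: lin_form_def\<close>)
  show "flip_op sY sX sZ DY DX DZ B = sconst \<alpha> * (of_int b - sY) * B"
    by (rule flip_op_eigen[where B = B and ?D1.0 = DY and ?D2.0 = DX and ?D3.0 = DZ,
          OF D(2,1,3) _ assms(3) abc(2) abc(6)])
      (use D(4) in \<open>simp add: lin_form_def add_ac\<close>)
  show "flip_op sZ sY sX DZ DY DX B = sconst \<alpha> * (of_int c - sZ) * B"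
    by (rule flip_op_eigen[where B = B and ?D1.0 = DZ and ?D2.0 = DY and ?D3.0 = DX,
          OF D(3,2,1) _ abc(3) abc(5) abc(4)])
      (use D(4) in \<open>simp add: lin_form_def add_ac\<close>)
qed

text \<open>The eigenvalues \<alpha> (a - X) of the four factors add up. By orthogonality of the
  four sign vectors (1, a, b, c), the exponents sum to n, and weighted with the signs a, b or c they
  sum to x, y or z.\<close>

lemma flip_op_gen_series:
  "flip_op sX sY sZ DX DY DZ (gen_series n) = (sconst px - of_nat n * sX) * gen_series n"
  "flip_op sY sX sZ DY DX DZ (gen_series n) = (sconst py - of_nat n * sY) * gen_series n"
  "flip_op sZ sY sX DZ DY DX (gen_series n) = (sconst pz - of_nat n * sZ) * gen_series n"
proof -
  let ?q = "sconst (pconst (1 / 4))"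
  have q: "?q * (4 * F) = F" for F
    using sconst_quarter by (simp add: mult.assoc[symmetric])
  \<comment> \<open>Writing the total eigenvalue as a quarter of 4t gives both sides the common
    factor 1/4, so the remaining goals are settled by expanding.\<close>
  have eq: "flip_op X Y Z D1 D2 D3 (F * G * H * K) = t * (F * G * H * K)"
    if "derivation D1" "derivation D2" "derivation D3"
      "flip_op X Y Z D1 D2 D3 F = f * F" "flip_op X Y Z D1 D2 D3 G = g * G"
      "flip_op X Y Z D1 D2 D3 H = h * H" "flip_op X Y Z D1 D2 D3 K = k * K"
      "f + g + h + k = ?q * (4 * t)"
    for X Y Z D1 D2 D3 f g h k t and F G H K :: series3
    using flip_op_mult[OF that(1-3) flip_op_mult[OF that(1-3)
      flip_op_mult[OF that(1-3) that(4,5)] that(6)] that(7)] that(8) by (simp add: q)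
  note D = derivation_DX derivation_DY derivation_DZ
  show "flip_op sX sY sZ DX DY DZ (gen_series n) = (sconst px - of_nat n * sX) * gen_series n"
    unfolding gen_series_eq
    by (rule eq[OF D(1-3) flip_op_binom_series(1) flip_op_binom_series(1)
          flip_op_binom_series(1) flip_op_binom_series(1)])
      (simp_all add: sconst_simps algebra_simps)
  show "flip_op sY sX sZ DY DX DZ (gen_series n) = (sconst py - of_nat n * sY) * gen_series n"
    unfolding gen_series_eq
    by (rule eq[OF D(2,1,3) flip_op_binom_series(2) flip_op_binom_series(2)
          flip_op_binom_series(2) flip_op_binom_series(2)])
      (simp_all add: sconst_simps algebra_simps)
  show "flip_op sZ sY sX DZ DY DX (gen_series n) = (sconst pz - of_nat n * sZ) * gen_series n"
    unfolding gen_series_eq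
    by (rule eq[OF D(3,2,1) flip_op_binom_series(3) flip_op_binom_series(3)
          flip_op_binom_series(3) flip_op_binom_series(3)])
      (simp_all add: sconst_simps algebra_simps)
qed

lemma coeff3_gen_series_0: "coeff3 (gen_series n) 0 0 0 = 1"
proof -
  have "coeff3 (F * G) 0 0 0 = coeff3 F 0 0 0 * coeff3 G 0 0 0" for F G :: series3
    by (simp add: coeff3_def)
  moreover have "coeff3 (binom_series (lin_form a b c) \<alpha>) 0 0 0 = 1" for a b c \<alpha>
    by (simp add: coeff3_binom_series coeff3_one pbinom_def) (simp add: pconst_def)
  ultimately show ?thesis by (simp add: gen_series_eq)
qed

text \<open>Coefficient comparison in the differential equations. The factor n + 1 - (r1 + r2 + r3)
  joins nX with X times the Euler operator, the latter read one degree lower. It is formed in the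
  ring, because it becomes negative for large indices.\<close>

lemma gen_series_rec:
  fixes n
  defines "Q \<equiv> coeff3 (gen_series n)"
  shows "px * Q r1 r2 r3 = of_nat (Suc r1) * Q (Suc r1) r2 r3
      + (if r1 = 0 then 0 else (of_nat (Suc n) - of_nat (r1 + r2 + r3)) * Q (r1 - 1) r2 r3)
      + (if r3 = 0 then 0 else of_nat (Suc r2) * Q r1 (Suc r2) (r3 - 1))
      + (if r2 = 0 then 0 else of_nat (Suc r3) * Q r1 (r2 - 1) (Suc r3))"
    "py * Q r1 r2 r3 = of_nat (Suc r2) * Q r1 (Suc r2) r3
      + (if r2 = 0 then 0 else (of_nat (Suc n) - of_nat (r1 + r2 + r3)) * Q r1 (r2 - 1) r3)
      + (if r3 = 0 then 0 else of_nat (Suc r1) * Q (Suc r1) r2 (r3 - 1))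
      + (if r1 = 0 then 0 else of_nat (Suc r3) * Q (r1 - 1) r2 (Suc r3))"
    "pz * Q r1 r2 r3 = of_nat (Suc r3) * Q r1 r2 (Suc r3)
      + (if r3 = 0 then 0 else (of_nat (Suc n) - of_nat (r1 + r2 + r3)) * Q r1 r2 (r3 - 1))
      + (if r1 = 0 then 0 else of_nat (Suc r2) * Q (r1 - 1) (Suc r2) r3)
      + (if r2 = 0 then 0 else of_nat (Suc r1) * Q (Suc r1) (r2 - 1) r3)"
proof -
  have e: "sX * DX F + sY * DY F + sZ * DZ F = euler_op F"
    "sY * DY F + sX * DX F + sZ * DZ F = euler_op F"
    "sZ * DZ F + sY * DY F + sX * DX F = euler_op F" for F
    by (simp_all add: euler_op_def add_ac)
  note c = arg_cong[where f = "\<lambda>F. coeff3 F r1 r2 r3"]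
  show "px * Q r1 r2 r3 = of_nat (Suc r1) * Q (Suc r1) r2 r3
      + (if r1 = 0 then 0 else (of_nat (Suc n) - of_nat (r1 + r2 + r3)) * Q (r1 - 1) r2 r3)
      + (if r3 = 0 then 0 else of_nat (Suc r2) * Q r1 (Suc r2) (r3 - 1))
      + (if r2 = 0 then 0 else of_nat (Suc r3) * Q r1 (r2 - 1) (Suc r3))"
    using c[OF flip_op_gen_series(1)[of n]]
    by (cases r1; cases r2; cases r3)
      (simp_all add: flip_op_def e coeff3_euler_op Q_def left_diff_distrib mult.assoc, simp_all add: algebra_simps)
  show "py * Q r1 r2 r3 = of_nat (Suc r2) * Q r1 (Suc r2) r3
      + (if r2 = 0 then 0 else (of_nat (Suc n) - of_nat (r1 + r2 + r3)) * Q r1 (r2 - 1) r3)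
      + (if r3 = 0 then 0 else of_nat (Suc r1) * Q (Suc r1) r2 (r3 - 1))
      + (if r1 = 0 then 0 else of_nat (Suc r3) * Q (r1 - 1) r2 (Suc r3))"
    using c[OF flip_op_gen_series(2)[of n]]
    by (cases r1; cases r2; cases r3)
      (simp_all add: flip_op_def e coeff3_euler_op Q_def left_diff_distrib mult.assoc, simp_all add: algebra_simps)
  show "pz * Q r1 r2 r3 = of_nat (Suc r3) * Q r1 r2 (Suc r3)
      + (if r3 = 0 then 0 else (of_nat (Suc n) - of_nat (r1 + r2 + r3)) * Q r1 r2 (r3 - 1))
      + (if r1 = 0 then 0 else of_nat (Suc r2) * Q (r1 - 1) (Suc r2) r3)
      + (if r2 = 0 then 0 else of_nat (Suc r1) * Q (Suc r1) (r2 - 1) r3)"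
    using c[OF flip_op_gen_series(3)[of n]]
    by (cases r1; cases r2; cases r3)
      (simp_all add: flip_op_def e coeff3_euler_op Q_def left_diff_distrib mult.assoc, simp_all add: algebra_simps)
qed

section \<open>The action of polynomials on row vectors\<close>

lemma cell_sum_cong:
  assumes "\<And>a b c. a + b + c \<le> n \<Longrightarrow> g a b c = h a b c"
  shows "cell_sum n C g i j k = cell_sum n C h i j k"
  unfolding cell_sum_def type_fun_def by (intro sum.cong refl assms odd_cards_le)

lemma cell_sum_add:
  "cell_sum n C (\<lambda>a b c. g a b c + h a b c) i j k = cell_sum n C g i j k + cell_sum n C h i j k"
  by (simp add: cell_sum_def type_fun_def sum.distrib)

lemma cell_sum_scale:
  "cell_sum n C (\<lambda>a b c. q * g a b c) i j k = q * cell_sum n C g i j k"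
  by (simp add: cell_sum_def type_fun_def sum_distrib_left)

text \<open>Each of the four terms of \<open>step1\<close> turns the indicator of a type into a
  multiple of the indicator of a neighbouring type. The resulting coefficients are those of the
  recurrence for \<open>px\<close> in \<open>gen_series_rec\<close>.\<close>

lemma step1_delta3:
  assumes "a + b + c \<le> n"
  shows "step1 n (delta3 r1 r2 r3) a b c =
    of_nat (Suc r1) * delta3 (Suc r1) r2 r3 a b c
    + (if r1 = 0 then 0 else of_nat (Suc n) - of_nat (r1 + r2 + r3)) * delta3 (r1 - 1) r2 r3 a b c
    + (if r3 = 0 then 0 else of_nat (Suc r2)) * delta3 r1 (Suc r2) (r3 - 1) a b c
    + (if r2 = 0 then 0 else of_nat (Suc r3)) * delta3 r1 (r2 - 1) (Suc r3) a b c"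
proof -
  have "of_nat a * delta3 r1 r2 r3 (a - 1) b c =
      of_nat (Suc r1) * delta3 (Suc r1) r2 r3 a b c"
    by (cases a) (auto simp: delta3_def)
  \<comment> \<open>The indicator forces a = r1 - 1, so n - (a + b + c) becomes n + 1 - (r1 + r2 +
    r3).\<close>
  moreover have "of_nat (n - (a + b + c)) * delta3 r1 r2 r3 (Suc a) b c =
      (if r1 = 0 then 0 else of_nat (Suc n) - of_nat (r1 + r2 + r3)) * delta3 (r1 - 1) r2 r3 a b c"
    using assms by (cases r1) (auto simp: delta3_def of_nat_diff)
  moreover have "of_nat b * delta3 r1 r2 r3 a (b - 1) (Suc c) =
      (if r3 = 0 then 0 else of_nat (Suc r2)) * delta3 r1 (Suc r2) (r3 - 1) a b c"
    by (cases b; cases r3) (auto simp: delta3_def)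
  moreover have "of_nat c * delta3 r1 r2 r3 a (Suc b) (c - 1) =
      (if r2 = 0 then 0 else of_nat (Suc r3)) * delta3 r1 (r2 - 1) (Suc r3) a b c"
    by (cases c; cases r2) (auto simp: delta3_def)
  ultimately show ?thesis by (simp only: step1_def)
qed

lemma delta3_perm:
  "(\<lambda>a b c. delta3 r1 r2 r3 b a c) = delta3 r2 r1 r3"
  "(\<lambda>a b c. delta3 r1 r2 r3 c b a) = delta3 r3 r2 r1"
  by (auto simp: delta3_def fun_eq_iff)

lemma delta3_perm':
  "delta3 r1 r2 r3 b a c = delta3 r2 r1 r3 a b c"
  "delta3 r1 r2 r3 c b a = delta3 r3 r2 r1 a b c"
  by (auto simp: delta3_def)

lemma step2_delta3:
  assumes "a + b + c \<le> n"
  shows "step2 n (delta3 r1 r2 r3) a b c =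
    of_nat (Suc r2) * delta3 r1 (Suc r2) r3 a b c
    + (if r2 = 0 then 0 else of_nat (Suc n) - of_nat (r1 + r2 + r3)) * delta3 r1 (r2 - 1) r3 a b c
    + (if r3 = 0 then 0 else of_nat (Suc r1)) * delta3 (Suc r1) r2 (r3 - 1) a b c
    + (if r1 = 0 then 0 else of_nat (Suc r3)) * delta3 (r1 - 1) r2 (Suc r3) a b c"
  using step1_delta3[of b a c n r2 r1 r3] assms
  by (simp add: step2_def delta3_perm delta3_perm'(1)[of _ _ _ b a c] add_ac)

lemma step3_delta3:
  assumes "a + b + c \<le> n"
  shows "step3 n (delta3 r1 r2 r3) a b c =
    of_nat (Suc r3) * delta3 r1 r2 (Suc r3) a b c
    + (if r3 = 0 then 0 else of_nat (Suc n) - of_nat (r1 + r2 + r3)) * delta3 r1 r2 (r3 - 1) a b c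
    + (if r1 = 0 then 0 else of_nat (Suc r2)) * delta3 (r1 - 1) (Suc r2) r3 a b c
    + (if r2 = 0 then 0 else of_nat (Suc r1)) * delta3 (Suc r1) (r2 - 1) r3 a b c"
  using step1_delta3[of c b a n r3 r2 r1] assms
  by (simp add: step3_def delta3_perm delta3_perm'(2)[of _ _ _ c b a] add_ac)

text \<open>Equality of row vectors of length m^3; entries with an index outside the range carry no
  meaning.\<close>

definition agree :: "nat \<Rightarrow> row3 \<Rightarrow> row3 \<Rightarrow> bool" where
  "agree m U V \<longleftrightarrow> (\<forall>i<m. \<forall>j<m. \<forall>k<m. U i j k = V i j k)"

lemma agree_trans: "agree m U V \<Longrightarrow> agree m V W \<Longrightarrow> agree m U W"
  by (simp add: agree_def)

lemma act_agree:
  assumes "agree m U V"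
  shows "agree m (act1 m S U) (act1 m S V)" "agree m (act2 m S U) (act2 m S V)"
    "agree m (act3 m S U) (act3 m S V)"
  using assms by (auto simp: agree_def act1_def act2_def act3_def)

lemma act_cell_sum_agree:
  assumes "equitable_partition n C S"
  shows "agree (length C) (act1 (length C) S (cell_sum n C g)) (cell_sum n C (step1 n g))"
    "agree (length C) (act2 (length C) S (cell_sum n C g)) (cell_sum n C (step2 n g))"
    "agree (length C) (act3 (length C) S (cell_sum n C g)) (cell_sum n C (step3 n g))"
  using assms by (simp_all add: agree_def act1_cell_sum act2_cell_sum act3_cell_sum)

lemma triple_vec_agree:
  assumes "equitable_partition n C S"
  shows "agree (length C) (triple_vec n C r1 r2 r3) (cell_sum n C (delta3 r1 r2 r3))"
  using assms by (simp add: agree_def triple_vec_eq_cell_sum)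

section \<open>Monomials and polynomials acting on row vectors\<close>

definition mono_act :: "nat \<Rightarrow> (nat \<Rightarrow> nat \<Rightarrow> nat) \<Rightarrow> nat \<times> nat \<times> nat \<Rightarrow> row3 \<Rightarrow> row3" where
  "mono_act m S = (\<lambda>(a, b, c) U. (act3 m S ^^ c) ((act2 m S ^^ b) ((act1 m S ^^ a) U)))"

lemma poly_act_superset:
  assumes "finite A" "Poly_Mapping.keys p \<subseteq> A"
  shows "poly_act m S p U i j k = (\<Sum>K\<in>A. Poly_Mapping.lookup p K * mono_act m S K U i j k)"
proof -
  have "poly_act m S p U i j k =
      (\<Sum>K\<in>Poly_Mapping.keys p. Poly_Mapping.lookup p K * mono_act m S K U i j k)"
    by (simp add: poly_act_def mono_act_def split_beta)
  also have "\<dots> = (\<Sum>K\<in>A. Poly_Mapping.lookup p K * mono_act m S K U i j k)"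
    using assms by (intro sum.mono_neutral_left) (auto simp: in_keys_iff)
  finally show ?thesis .
qed

lemma poly_act_0: "poly_act m S 0 U i j k = 0"
  by (simp add: poly_act_def)

lemma poly_act_add: "poly_act m S (p + q) U i j k = poly_act m S p U i j k + poly_act m S q U i j k"
proof -
  let ?A = "Poly_Mapping.keys p \<union> Poly_Mapping.keys q"
  have "Poly_Mapping.keys (p + q) \<subseteq> ?A" by (rule Poly_Mapping.keys_add)
  then show ?thesis
    by (simp add: poly_act_superset[of ?A] lookup_add distrib_right sum.distrib)
qed

lemma lookup_pconst_mult: "Poly_Mapping.lookup (pconst q * p) K = q * Poly_Mapping.lookup p K"
  unfolding pconst_def mult_map_scale_conv_mult[symmetric]
  by (simp add: Poly_Mapping.map.rep_eq when_def)

lemma keys_pconst_mult: "Poly_Mapping.keys (pconst q * p) \<subseteq> Poly_Mapping.keys p"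
  by (auto simp: in_keys_iff lookup_pconst_mult)

lemma poly_act_pconst_mult: "poly_act m S (pconst q * p) U i j k = q * poly_act m S p U i j k"
  by (simp add: poly_act_superset[OF finite_keys keys_pconst_mult]
      poly_act_superset[OF finite_keys subset_refl, of m S p] lookup_pconst_mult
      sum_distrib_left mult.assoc)

lemma poly_act_single:
  "poly_act m S (Poly_Mapping.single K v) U i j k = v * mono_act m S K U i j k"
  by (simp add: poly_act_superset[of "{K}"])

text \<open>Setting a fresh key amounts to adding a monomial, so additive statements about
  polynomials need a check on monomials only.\<close>

lemma poly_mapping_additive_induct [case_names zero add single]:
  fixes p :: "'a \<Rightarrow>\<^sub>0 'b::comm_monoid_add"
  assumes "P 0" "\<And>p q. P p \<Longrightarrow> P q \<Longrightarrow> P (p + q)" "\<And>k v. P (Poly_Mapping.single k v)"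
  shows "P p"
proof (induction p rule: update_induct)
  case const
  then show ?case by (rule assms(1))
next
  case (update f k v)
  have "Poly_Mapping.update k v f = f + Poly_Mapping.single k v"
    using update by (intro poly_mapping_eqI)
      (auto simp: lookup_update lookup_add lookup_single in_keys_iff)
  then show ?case using assms(2)[OF update(3) assms(3)] by simp
qed

lemma act_linear:
  "act1 m S (\<lambda>i j k. U i j k + V i j k) = (\<lambda>i j k. act1 m S U i j k + act1 m S V i j k)"
  "act2 m S (\<lambda>i j k. U i j k + V i j k) = (\<lambda>i j k. act2 m S U i j k + act2 m S V i j k)"
  "act3 m S (\<lambda>i j k. U i j k + V i j k) = (\<lambda>i j k. act3 m S U i j k + act3 m S V i j k)"
  "act1 m S (\<lambda>i j k. q * U i j k) = (\<lambda>i j k. q * act1 m S U i j k)"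
  "act2 m S (\<lambda>i j k. q * U i j k) = (\<lambda>i j k. q * act2 m S U i j k)"
  "act3 m S (\<lambda>i j k. q * U i j k) = (\<lambda>i j k. q * act3 m S U i j k)"
  by (simp_all add: act1_def act2_def act3_def distrib_right sum.distrib sum_distrib_left mult.assoc)

lemma act_commute:
  "act1 m S (act2 m S U) = act2 m S (act1 m S U)"
  "act1 m S (act3 m S U) = act3 m S (act1 m S U)"
  "act2 m S (act3 m S U) = act3 m S (act2 m S U)"
proof -
  show "act1 m S (act2 m S U) = act2 m S (act1 m S U)"
    unfolding act1_def act2_def sum_distrib_right
    by (intro ext, subst sum.swap) (simp add: mult_ac)
  show "act1 m S (act3 m S U) = act3 m S (act1 m S U)"
    unfolding act1_def act3_def sum_distrib_right
    by (intro ext, subst sum.swap) (simp add: mult_ac)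
  show "act2 m S (act3 m S U) = act3 m S (act2 m S U)"
    unfolding act2_def act3_def sum_distrib_right
    by (intro ext, subst sum.swap) (simp add: mult_ac)
qed

lemma funpow_commute_apply: "(\<And>x. f (g x) = g (f x)) \<Longrightarrow> f ((g ^^ k) x) = (g ^^ k) (f x)"
  by (induction k) simp_all

lemma act_mono_act:
  "act1 m S (mono_act m S (a, b, c) U) = mono_act m S (Suc a, b, c) U"
  "act2 m S (mono_act m S (a, b, c) U) = mono_act m S (a, Suc b, c) U"
  "act3 m S (mono_act m S (a, b, c) U) = mono_act m S (a, b, Suc c) U"
  by (simp_all add: mono_act_def funpow_commute_apply[of "act1 m S" "act3 m S", OF act_commute(2)]
      funpow_commute_apply[of "act1 m S" "act2 m S", OF act_commute(1)]
      funpow_commute_apply[of "act2 m S" "act3 m S", OF act_commute(3)])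

text \<open>Both sides are additive in p, so the claim reduces to monomials, where it is the
  assumption \<open>mono\<close>. The abstract \<open>act\<close> covers the three variables at
  once.\<close>

lemma poly_act_var_mult:
  assumes zero: "act (\<lambda>i j k. 0) = (\<lambda>i j k. 0)"
    and add: "\<And>U V. act (\<lambda>i j k. U i j k + V i j k) = (\<lambda>i j k. act U i j k + act V i j k)"
    and scale: "\<And>q U. act (\<lambda>i j k. q * U i j k) = (\<lambda>i j k. q * act U i j k)"
    and mono: "\<And>K. act (mono_act m S K U) = mono_act m S (e + K) U"
  shows "poly_act m S (Poly_Mapping.single e 1 * p) U = act (poly_act m S p U)"
proof (induction p rule: poly_mapping_additive_induct)
  case zero
  then show ?case using assms(1) by (simp add: poly_act_0[abs_def] fun_eq_iff)
next
  case (add p q)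
  then show ?case using assms(2) by (simp add: distrib_left poly_act_add[abs_def] fun_eq_iff)
next
  case (single k v)
  then show ?case using assms(3,4) by (simp add: mult_single poly_act_single[abs_def] fun_eq_iff)
qed

lemma poly_act_var:
  "poly_act m S (px * p) U = act1 m S (poly_act m S p U)"
  "poly_act m S (py * p) U = act2 m S (poly_act m S p U)"
  "poly_act m S (pz * p) U = act3 m S (poly_act m S p U)"
  unfolding px_def py_def pz_def
  by (safe intro!: poly_act_var_mult)
    (simp_all add: act_linear act_mono_act, simp_all add: act1_def act2_def act3_def)

section \<open>Degree bounds\<close>

definition deg_le :: "nat \<Rightarrow> qpoly3 \<Rightarrow> bool" where
  "deg_le d p \<longleftrightarrow> (\<forall>a b c. Poly_Mapping.lookup p (a, b, c) \<noteq> 0 \<longrightarrow> a + b + c \<le> d)"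

lemma total_degree_le_iff: "total_degree p \<le> d \<longleftrightarrow> deg_le d p"
  by (force simp: total_degree_def deg_le_def in_keys_iff)

lemma deg_le_0: "deg_le d 0"
  by (simp add: deg_le_def)

lemma deg_le_mono: "deg_le d p \<Longrightarrow> d \<le> e \<Longrightarrow> deg_le e p"
  using le_trans unfolding deg_le_def by blast

lemma deg_le_diff: "deg_le d p \<Longrightarrow> deg_le d q \<Longrightarrow> deg_le d (p - q)"
  unfolding deg_le_def lookup_minus by (metis diff_self)

lemma deg_le_pconst_mult: "deg_le d p \<Longrightarrow> deg_le d (pconst q * p)"
  unfolding deg_le_def lookup_pconst_mult by simp

lemma deg_le_pconst_multD: "deg_le d (pconst q * p) \<Longrightarrow> q \<noteq> 0 \<Longrightarrow> deg_le d p"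
  unfolding deg_le_def lookup_pconst_mult by simp

lemma deg_le_var_mult:
  assumes "deg_le d p"
  shows "deg_le (Suc d) (px * p)" "deg_le (Suc d) (py * p)" "deg_le (Suc d) (pz * p)"
  using assms keys_mult[of px p] keys_mult[of py p] keys_mult[of pz p]
  unfolding deg_le_def px_def py_def pz_def in_keys_iff[symmetric] by fastforce+

text \<open>The vector depends on the partition while the polynomial does not: one p has to serve
  all equitable partitions.\<close>

definition represents :: "nat \<Rightarrow> (bool list set list \<Rightarrow> row3) \<Rightarrow> qpoly3 \<Rightarrow> bool" where
  "represents n T p \<longleftrightarrow> (\<forall>C S. equitable_partition n C S \<longrightarrow>
     agree (length C) (T C) (poly_act (length C) S p (triple_vec n C 0 0 0)))"

lemma is_triple_poly_iff:
  "is_triple_poly n r1 r2 r3 p \<longleftrightarrow>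
    deg_le (r1 + r2 + r3) p \<and> represents n (\<lambda>C. triple_vec n C r1 r2 r3) p"
  by (simp add: is_triple_poly_def represents_def agree_def total_degree_le_iff)

lemma pconst_diff: "pconst (p - q) = pconst p - pconst q"
  by (simp add: pconst_def single_diff)

text \<open>The polynomials and the vectors satisfy the same recurrence; solving both for the top
  term, by subtracting the rest and dividing by l + 1, carries the representation over to
  \<open>Q1\<close>. The flags z2, z3, z4 switch off terms whose index would be negative, and
  \<open>Q2\<close>, \<open>Q3\<close>, \<open>Q4\<close> are constrained only where their terms are
  present.\<close>

lemma is_triple_poly_step:
  assumes rec: "w * Q0 = of_nat (Suc l) * Q1
      + (if z2 then 0 else (of_nat s - of_nat t) * Q2)
      + (if z3 then 0 else of_nat l3 * Q3) + (if z4 then 0 else of_nat l4 * Q4)"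
    and act: "\<And>m S p U. poly_act m S (w * p) U = act m S (poly_act m S p U)"
    and cong: "\<And>m S U V. agree m U V \<Longrightarrow> agree m (act m S U) (act m S V)"
    and deg_w: "deg_le (Suc d) (w * Q0)"
    and vec: "\<And>C S. equitable_partition n C S \<Longrightarrow> agree (length C) (act (length C) S (T0 C))
      (\<lambda>i j k. of_nat (Suc l) * T1 C i j k
        + (if z2 then 0 else of_nat s - of_nat t) * T2 C i j k
        + (if z3 then 0 else of_nat l3) * T3 C i j k + (if z4 then 0 else of_nat l4) * T4 C i j k)"
    and T0: "represents n T0 Q0"
    and Q2: "\<not> z2 \<Longrightarrow> deg_le d Q2 \<and> represents n T2 Q2"
    and Q3: "\<not> z3 \<Longrightarrow> deg_le d Q3 \<and> represents n T3 Q3"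
    and Q4: "\<not> z4 \<Longrightarrow> deg_le d Q4 \<and> represents n T4 Q4"
  shows "deg_le (Suc d) Q1 \<and> represents n T1 Q1"
proof
  \<comment> \<open>Moving the flags into rational scalars gives the two recurrences literally the
    same coefficients.\<close>
  define q2 q3 q4 :: rat where "q2 = (if z2 then 0 else of_nat s - of_nat t)"
    and "q3 = (if z3 then 0 else of_nat l3)" and "q4 = (if z4 then 0 else of_nat l4)"
  note q_defs = q2_def q3_def q4_def
  have pconst_0: "pconst 0 = 0" by (simp add: pconst_def)
  have rec': "w * Q0 = pconst (of_nat (Suc l)) * Q1
      + pconst q2 * Q2 + pconst q3 * Q3 + pconst q4 * Q4"
    unfolding rec q_defs
    by (simp add: pconst_0 pconst_diff pconst_of_nat del: of_nat_Suc)
  have deg: "deg_le (Suc d) (pconst q2 * Q2)" "deg_le (Suc d) (pconst q3 * Q3)"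
    "deg_le (Suc d) (pconst q4 * Q4)"
    using Q2 Q3 Q4 deg_le_mono[of d _ "Suc d"]
    by (auto simp: q_defs pconst_0 deg_le_0 intro!: deg_le_pconst_mult)
  have "pconst (of_nat (Suc l)) * Q1 = w * Q0 - pconst q2 * Q2 - pconst q3 * Q3 - pconst q4 * Q4"
    using rec' by (simp add: algebra_simps)
  also have "deg_le (Suc d) \<dots>"
    by (intro deg_le_diff deg_w deg)
  finally show "deg_le (Suc d) Q1" by (rule deg_le_pconst_multD) simp
  show "represents n T1 Q1"
    unfolding represents_def
  proof (intro allI impI)
    fix C S assume ep: "equitable_partition n C S"
    let ?m = "length C" and ?U = "triple_vec n C 0 0 0"
    \<comment> \<open>If a flag is set, the scalar is 0 and nothing has to be known about the
      vector.\<close>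
    have q: "q2 * T2 C i j k = q2 * poly_act ?m S Q2 ?U i j k"
      "q3 * T3 C i j k = q3 * poly_act ?m S Q3 ?U i j k"
      "q4 * T4 C i j k = q4 * poly_act ?m S Q4 ?U i j k"
      if "i < ?m" "j < ?m" "k < ?m" for i j k
      using Q2 Q3 Q4 ep that by (auto simp: q_defs represents_def agree_def)
    have "agree ?m (act ?m S (T0 C)) (poly_act ?m S (w * Q0) ?U)"
      unfolding act using T0 ep by (intro cong) (simp add: represents_def)
    then show "agree ?m (T1 C) (poly_act ?m S Q1 ?U)"
      using vec[OF ep, folded q_defs] unfolding rec'
      by (simp add: agree_def poly_act_add poly_act_pconst_mult q del: of_nat_Suc)
  qed
qed

text \<open>Summing an identity between type functions over the cells turns the recurrence for
  indicators into one for T.\<close>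

lemma agree_triple_vec_rec:
  assumes ep: "equitable_partition n C S"
    and act: "agree (length C) (act (cell_sum n C (delta3 r1 r2 r3)))
      (cell_sum n C (step (delta3 r1 r2 r3)))"
    and cong: "\<And>U V. agree (length C) U V \<Longrightarrow> agree (length C) (act U) (act V)"
    and step: "\<And>a b c. a + b + c \<le> n \<Longrightarrow> step (delta3 r1 r2 r3) a b c =
      q1 * delta3 s1 s2 s3 a b c + q2 * delta3 t1 t2 t3 a b c
      + q3 * delta3 u1 u2 u3 a b c + q4 * delta3 v1 v2 v3 a b c"
  shows "agree (length C) (act (triple_vec n C r1 r2 r3))
    (\<lambda>i j k. q1 * triple_vec n C s1 s2 s3 i j k + q2 * triple_vec n C t1 t2 t3 i j k
      + q3 * triple_vec n C u1 u2 u3 i j k + q4 * triple_vec n C v1 v2 v3 i j k)"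
proof -
  have "agree (length C) (act (triple_vec n C r1 r2 r3)) (cell_sum n C (step (delta3 r1 r2 r3)))"
    using cong[OF triple_vec_agree[OF ep]] act by (rule agree_trans)
  moreover have "cell_sum n C (step (delta3 r1 r2 r3)) i j k =
      q1 * cell_sum n C (delta3 s1 s2 s3) i j k + q2 * cell_sum n C (delta3 t1 t2 t3) i j k
      + q3 * cell_sum n C (delta3 u1 u2 u3) i j k + q4 * cell_sum n C (delta3 v1 v2 v3) i j k"
    for i j k
    by (subst cell_sum_cong[OF step]) (simp_all add: cell_sum_add cell_sum_scale)
  ultimately show ?thesis by (simp add: agree_def triple_vec_eq_cell_sum[OF ep])
qed

lemma triple_vec_rec1:
  assumes ep: "equitable_partition n C S"
  shows "agree (length C) (act1 (length C) S (triple_vec n C r1 r2 r3)) (\<lambda>i j k.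
    of_nat (Suc r1) * triple_vec n C (Suc r1) r2 r3 i j k
    + (if r1 = 0 then 0 else of_nat (Suc n) - of_nat (r1 + r2 + r3))
      * triple_vec n C (r1 - 1) r2 r3 i j k
    + (if r3 = 0 then 0 else of_nat (Suc r2)) * triple_vec n C r1 (Suc r2) (r3 - 1) i j k
    + (if r2 = 0 then 0 else of_nat (Suc r3)) * triple_vec n C r1 (r2 - 1) (Suc r3) i j k)"
  by (rule agree_triple_vec_rec[where act = "act1 (length C) S" and step = "step1 n",
        OF ep act_cell_sum_agree(1)[OF ep] act_agree(1) step1_delta3])

lemma triple_vec_rec2:
  assumes ep: "equitable_partition n C S"
  shows "agree (length C) (act2 (length C) S (triple_vec n C r1 r2 r3)) (\<lambda>i j k.
    of_nat (Suc r2) * triple_vec n C r1 (Suc r2) r3 i j k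
    + (if r2 = 0 then 0 else of_nat (Suc n) - of_nat (r1 + r2 + r3))
      * triple_vec n C r1 (r2 - 1) r3 i j k
    + (if r3 = 0 then 0 else of_nat (Suc r1)) * triple_vec n C (Suc r1) r2 (r3 - 1) i j k
    + (if r1 = 0 then 0 else of_nat (Suc r3)) * triple_vec n C (r1 - 1) r2 (Suc r3) i j k)"
  by (rule agree_triple_vec_rec[where act = "act2 (length C) S" and step = "step2 n",
        OF ep act_cell_sum_agree(2)[OF ep] act_agree(2) step2_delta3])

lemma triple_vec_rec3:
  assumes ep: "equitable_partition n C S"
  shows "agree (length C) (act3 (length C) S (triple_vec n C r1 r2 r3)) (\<lambda>i j k.
    of_nat (Suc r3) * triple_vec n C r1 r2 (Suc r3) i j k
    + (if r3 = 0 then 0 else of_nat (Suc n) - of_nat (r1 + r2 + r3))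
      * triple_vec n C r1 r2 (r3 - 1) i j k
    + (if r1 = 0 then 0 else of_nat (Suc r2)) * triple_vec n C (r1 - 1) (Suc r2) r3 i j k
    + (if r2 = 0 then 0 else of_nat (Suc r1)) * triple_vec n C (Suc r1) (r2 - 1) r3 i j k)"
  by (rule agree_triple_vec_rec[where act = "act3 (length C) S" and step = "step3 n",
        OF ep act_cell_sum_agree(3)[OF ep] act_agree(3) step3_delta3])

section \<open>Existence and uniqueness\<close>

text \<open>Any positive index can be lowered by one; the recurrence at the lowered type has the
  desired type as its only term of the current degree, and all its other terms have smaller
  degree.\<close>

lemma is_triple_poly_gen_series: "is_triple_poly n r1 r2 r3 (coeff3 (gen_series n) r1 r2 r3)"
proof (induction "r1 + r2 + r3" arbitrary: r1 r2 r3 rule: less_induct)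
  case less
  let ?Q = "coeff3 (gen_series n)" and ?T = "\<lambda>r1 r2 r3 C. triple_vec n C r1 r2 r3"
  have deg: "deg_le d (?Q s1 s2 s3)"
    if "s1 + s2 + s3 \<le> d" "d < r1 + r2 + r3" for s1 s2 s3 d
    using less[of s1 s2 s3] that by (auto simp: is_triple_poly_iff intro: deg_le_mono)
  have rep: "represents n (?T s1 s2 s3) (?Q s1 s2 s3)"
    if "s1 + s2 + s3 < r1 + r2 + r3" for s1 s2 s3
    using less[of s1 s2 s3] that by (simp add: is_triple_poly_iff)
  consider (zero) "r1 = 0" "r2 = 0" "r3 = 0" | (one) s where "r1 = Suc s"
    | (two) s where "r2 = Suc s" | (three) s where "r3 = Suc s"
    by (metis not0_implies_Suc)
  then show ?case
  proof cases
    case zero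
    have "?Q 0 0 0 = Poly_Mapping.single (0, 0, 0) 1"
      by (simp add: coeff3_gen_series_0 flip: zero_prod_def)
    then show ?thesis using zero
      by (simp add: is_triple_poly_iff deg_le_def represents_def agree_def poly_act_single
          mono_act_def lookup_single when_def)
  next
    case one
    have "deg_le (Suc (s + r2 + r3)) (?Q (Suc s) r2 r3) \<and>
        represents n (?T (Suc s) r2 r3) (?Q (Suc s) r2 r3)"
      by (rule is_triple_poly_step[where act = act1, OF gen_series_rec(1) poly_act_var(1)
            act_agree(1) _ triple_vec_rec1])
        (simp_all add: one deg rep deg_le_var_mult)
    then show ?thesis by (simp add: one is_triple_poly_iff)
  next
    case two
    have "deg_le (Suc (r1 + s + r3)) (?Q r1 (Suc s) r3) \<and>
        represents n (?T r1 (Suc s) r3) (?Q r1 (Suc s) r3)"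
      by (rule is_triple_poly_step[where act = act2, OF gen_series_rec(2) poly_act_var(2)
            act_agree(2) _ triple_vec_rec2])
        (simp_all add: two deg rep deg_le_var_mult)
    then show ?thesis by (simp add: two is_triple_poly_iff)
  next
    case three
    have "deg_le (Suc (r1 + r2 + s)) (?Q r1 r2 (Suc s)) \<and>
        represents n (?T r1 r2 (Suc s)) (?Q r1 r2 (Suc s))"
      by (rule is_triple_poly_step[where act = act3, OF gen_series_rec(3) poly_act_var(3)
            act_agree(3) _ triple_vec_rec3])
        (simp_all add: three deg rep deg_le_var_mult)
    then show ?thesis by (simp add: three is_triple_poly_iff)
  qed
qed

section \<open>Uniqueness by triangularity: leading types\<close>

definition leading_at :: "row3 \<Rightarrow> nat \<Rightarrow> nat \<Rightarrow> nat \<Rightarrow> bool" where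
  "leading_at g a b c \<longleftrightarrow> g a b c \<noteq> 0 \<and>
     (\<forall>a' b' c'. a + b + c \<le> a' + b' + c' \<longrightarrow> (a', b', c') \<noteq> (a, b, c) \<longrightarrow> g a' b' c' = 0)"

lemma leading_at_delta3: "leading_at (delta3 0 0 0) 0 0 0"
  by (simp add: leading_at_def delta3_def)

text \<open>Above the degree of the leading type, three terms of \<open>step1\<close> read g in the
  same or a higher degree and vanish. The remaining term moves the leading type to (a + 1, b, c) and
  multiplies its value by the nonzero factor a + 1.\<close>

lemma leading_at_step1:
  assumes "leading_at g a b c"
  shows "leading_at (step1 n g) (Suc a) b c"
proof -
  have g: "g a' b' c' = 0" if "a + b + c < a' + b' + c'" for a' b' c'
    using assms that by (auto simp: leading_at_def)
  have step: "step1 n g a' b' c' = of_nat a' * g (a' - 1) b' c'"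
    if "a + b + c < a' + b' + c'" for a' b' c'
    using that by (cases b'; cases c') (simp_all add: step1_def g)
  show ?thesis
    unfolding leading_at_def
  proof (intro conjI allI impI)
    show "step1 n g (Suc a) b c \<noteq> 0"
      using assms by (simp add: step leading_at_def del: of_nat_Suc)
    fix a' b' c'
    assume "Suc a + b + c \<le> a' + b' + c'" "(a', b', c') \<noteq> (Suc a, b, c)"
    then show "step1 n g a' b' c' = 0"
      using assms by (cases a') (auto simp: step leading_at_def)
  qed
qed

lemma leading_at_perm:
  "leading_at (\<lambda>a b c. g b a c) b a c \<longleftrightarrow> leading_at g a b c"
  "leading_at (\<lambda>a b c. g c b a) c b a \<longleftrightarrow> leading_at g a b c"
  unfolding leading_at_def by (auto simp: add_ac)

lemma leading_at_step2: "leading_at g a b c \<Longrightarrow> leading_at (step2 n g) a (Suc b) c"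
  using leading_at_step1[of "\<lambda>a b c. g b a c" b a c n]
    leading_at_perm(1)[of "step1 n (\<lambda>a b c. g b a c)" a "Suc b" c]
  by (simp add: step2_def leading_at_perm(1)[of g])

lemma leading_at_step3: "leading_at g a b c \<Longrightarrow> leading_at (step3 n g) a b (Suc c)"
  using leading_at_step1[of "\<lambda>a b c. g c b a" c b a n]
    leading_at_perm(2)[of "step1 n (\<lambda>a b c. g c b a)" a b "Suc c"]
  by (simp add: step3_def leading_at_perm(2)[of g])

definition mono_step :: "nat \<Rightarrow> nat \<times> nat \<times> nat \<Rightarrow> row3" where
  "mono_step n = (\<lambda>(a, b, c). (step3 n ^^ c) ((step2 n ^^ b) ((step1 n ^^ a) (delta3 0 0 0))))"

lemma leading_at_mono_step: "leading_at (mono_step n (a, b, c)) a b c"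
proof -
  have 1: "leading_at ((step1 n ^^ a) (delta3 0 0 0)) a 0 0"
    by (induction a) (simp_all add: leading_at_delta3 leading_at_step1)
  have 2: "leading_at ((step2 n ^^ b) ((step1 n ^^ a) (delta3 0 0 0))) a b 0"
    by (induction b) (simp_all add: 1 leading_at_step2)
  show ?thesis
    unfolding mono_step_def prod.case
    by (induction c) (simp_all add: 2 leading_at_step3)
qed

lemma mono_act_agree:
  assumes ep: "equitable_partition n C S"
  shows "agree (length C) (mono_act (length C) S K (triple_vec n C 0 0 0))
    (cell_sum n C (mono_step n K))"
proof -
  obtain a b c where K: "K = (a, b, c)" by (cases K)
  have pow: "agree (length C) ((act ^^ k) U) (cell_sum n C ((step ^^ k) g))"
    if "agree (length C) U (cell_sum n C g)"
      "\<And>U V. agree (length C) U V \<Longrightarrow> agree (length C) (act U) (act V)"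
      "\<And>g. agree (length C) (act (cell_sum n C g)) (cell_sum n C (step g))"
    for act step k U g
    by (induction k) (use that in \<open>auto intro: agree_trans\<close>)
  show ?thesis
    unfolding K mono_act_def mono_step_def prod.case
    by (intro pow triple_vec_agree[OF ep] act_agree act_cell_sum_agree[OF ep])
qed

text \<open>For singleton cells a cell sum is a single value of the type function, so this partition
  separates the types.\<close>

lemma ex_singleton_partition:
  "\<exists>vs S. set vs = cube_verts n \<and> equitable_partition n (map (\<lambda>v. {v}) vs) S"
proof -
  obtain vs where vs: "set vs = cube_verts n" "distinct vs"
    using finite_distinct_list[OF finite_cube_verts] by blast
  let ?C = "map (\<lambda>v. {v}) vs"
  let ?S = "\<lambda>i j. card {w \<in> ?C ! j. (vs ! i, w) \<in> cube_edges n}"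
  have "distinct ?C" using vs by (simp add: distinct_map inj_on_def)
  moreover have "partition_on (cube_verts n) (set ?C)"
    using vs by (auto simp: partition_on_def disjoint_def)
  ultimately have "equitable_partition n ?C ?S"
    by (auto simp: equitable_partition_def)
  with vs show ?thesis by blast
qed

lemma ex_triple_of_type:
  assumes "a + b + c \<le> n"
  shows "\<exists>v x y. v \<in> cube_verts n \<and> x \<in> cube_verts n \<and> y \<in> cube_verts n \<and>
    odd_card n v x y = a \<and> odd_card n x v y = b \<and> odd_card n y v x = c"
proof -
  \<comment> \<open>The words are supported on consecutive blocks of lengths a, b and c. Inside a
    block only one word is true, and outside the blocks all are false.\<close>
  define v where "v = map (\<lambda>i. i < a) [0..<n]"
  define x where "x = map (\<lambda>i. a \<le> i \<and> i < a + b) [0..<n]"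
  define y where "y = map (\<lambda>i. a + b \<le> i \<and> i < a + b + c) [0..<n]"
  have "odd_set n v x y = {..<a}" "odd_set n x v y = {a..<a + b}"
    "odd_set n y v x = {a + b..<a + b + c}"
    using assms by (auto simp: odd_set_def v_def x_def y_def)
  then have "odd_card n v x y = a" "odd_card n x v y = b" "odd_card n y v x = c"
    by (simp_all add: odd_card_def)
  moreover have "v \<in> cube_verts n" "x \<in> cube_verts n" "y \<in> cube_verts n"
    by (simp_all add: v_def x_def y_def cube_verts_def)
  ultimately show ?thesis by blast
qed

text \<open>Take a monomial of maximal degree in p and a vertex triple whose type is its exponent.
  Evaluated there, all other monomials of p contribute 0 and this one does not, so p cannot act as
  zero. The degree bound guarantees that such a triple exists.\<close>

lemma represents_0_imp_eq_0:
  assumes rep: "represents n (\<lambda>C i j k. 0) p" and deg: "deg_le n p"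
  shows "p = 0"
proof (rule ccontr)
  assume "p \<noteq> 0"
  let ?K = "Poly_Mapping.keys p" and ?h = "\<lambda>(a, b, c). a + b + c :: nat"
  have "Max (?h ` ?K) \<in> ?h ` ?K" using \<open>p \<noteq> 0\<close> by (intro Max_in) auto
  then obtain a b c where M: "(a, b, c) \<in> ?K" and M_max: "Max (?h ` ?K) = a + b + c"
    by (auto simp: image_iff)
  have max: "?h L \<le> a + b + c" if "L \<in> ?K" for L
    unfolding M_max[symmetric] using that by (intro Max_ge) auto
  have "a + b + c \<le> n" using deg M by (auto simp: deg_le_def in_keys_iff)
  then obtain v x y where vert: "v \<in> cube_verts n" "x \<in> cube_verts n" "y \<in> cube_verts n"
    and odd: "odd_card n v x y = a" "odd_card n x v y = b" "odd_card n y v x = c"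
    using ex_triple_of_type by blast
  obtain vs S where vs: "set vs = cube_verts n"
    and ep: "equitable_partition n (map (\<lambda>v. {v}) vs) S"
    using ex_singleton_partition by blast
  let ?C = "map (\<lambda>v. {v}) vs"
  obtain i j k where ijk: "i < length ?C" "j < length ?C" "k < length ?C"
    and nth: "vs ! i = v" "vs ! j = x" "vs ! k = y"
    using vert vs by (metis in_set_conv_nth length_map)
  have mono: "mono_act (length ?C) S L (triple_vec n ?C 0 0 0) i j k = mono_step n L a b c" for L
    using mono_act_agree[OF ep, of L] ijk odd nth
    by (simp add: agree_def cell_sum_def type_fun_def)
  have "0 = poly_act (length ?C) S p (triple_vec n ?C 0 0 0) i j k"
    using rep[unfolded represents_def, rule_format, OF ep] ijk by (simp add: agree_def)
  also have "\<dots> = (\<Sum>L\<in>?K. Poly_Mapping.lookup p L * mono_step n L a b c)"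
    unfolding poly_act_superset[OF finite_keys subset_refl] mono ..
  \<comment> \<open>Any other key has degree at most a + b + c, so (a, b, c) differs from its
    leading type without having smaller degree, and its value there is 0.\<close>
  also have "\<dots> = (\<Sum>L\<in>{(a, b, c)}. Poly_Mapping.lookup p L * mono_step n L a b c)"
  proof (intro sum.mono_neutral_right ballI)
    fix L assume L: "L \<in> ?K - {(a, b, c)}"
    obtain a' b' c' where L': "L = (a', b', c')" by (cases L)
    then have "mono_step n L a b c = 0"
      using leading_at_mono_step[of n a' b' c'] max[of L] L by (auto simp: leading_at_def)
    then show "Poly_Mapping.lookup p L * mono_step n L a b c = 0" by simp
  qed (use M in auto)
  also have "\<dots> \<noteq> 0"
    using M leading_at_mono_step[of n a b c] by (simp add: leading_at_def in_keys_iff)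
  finally show False by simp
qed

lemma is_triple_poly_unique:
  assumes "r1 + r2 + r3 \<le> n" "is_triple_poly n r1 r2 r3 p" "is_triple_poly n r1 r2 r3 q"
  shows "p = q"
proof -
  have "deg_le n (p - q)"
    using assms by (intro deg_le_diff) (auto simp: is_triple_poly_iff intro: deg_le_mono)
  moreover have "represents n (\<lambda>C i j k. 0) (p - q)"
  proof -
    have "poly_act m S (p - q) U i j k = poly_act m S p U i j k - poly_act m S q U i j k"
      for m S U i j k
      using poly_act_add[of m S "p - q" q U i j k] by simp
    then show ?thesis
      using assms(2,3) by (simp add: is_triple_poly_iff represents_def agree_def)
  qed
  ultimately have "p - q = 0" by (intro represents_0_imp_eq_0)
  then show ?thesis by simp
qed

theorem theorem3:
  fixes n r1 r2 r3 :: nat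
  assumes "r1 + r2 + r3 \<le> n"
  shows "(\<exists>!p. is_triple_poly n r1 r2 r3 p) \<and>
         coeff3 (gen_series n) r1 r2 r3 = triple_poly n r1 r2 r3"
proof
  show ex1: "\<exists>!p. is_triple_poly n r1 r2 r3 p"
    using is_triple_poly_gen_series is_triple_poly_unique[OF assms] by blast
  show "coeff3 (gen_series n) r1 r2 r3 = triple_poly n r1 r2 r3"
    unfolding triple_poly_def
    using the1_equality[OF ex1 is_triple_poly_gen_series] by (rule sym)
qed

end
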